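(* Let $G$ be a finite simple graph with $n$ vertices and let $s$ be a positive integer with $s\leq \mathrm{match}(G)$. Then $$\mathrm{reg}\big(I(G)^{[s]}\big)\leq s+\lfloor n/2\rfloor.$$ In particular, if $G$ has a matching of size $\lfloor n/2\rfloor$, then $\mathrm{reg}\big(I(G)^{[s]}\big)\leq \mathrm{match}(G)+s$ for every positive integer $s\leq \mathrm{match}(G)$.
   Context: Let $\mathbb{K}$ be a field and $S=\mathbb{K}[x_1,\ldots,x_n]$ the standard graded polynomial ring. For a finite simple graph $G$ with vertex set $V(G)=\{x_1,\ldots,x_n\}$ (vertices are identified with variables of $S$), the edge ideal is $I(G)=(x_ix_j : x_ix_j\in E(G))\subseteq S$. A matching is a set of pairwise disjoint edges, and $\mathrm{match}(G)$ is the maximum size of a matching of $G$. For a squarefree monomial ideal $I$, the $s$-th squarefree power $I^{[s]}$ is the ideal generated by the squarefree monomials belonging to $I^s$; thus $I(G)^{[s]}$ is generated by the products $e_1\cdots e_s$ with $\{e_1,\ldots,e_s\}$ a matching of $G$. For a finitely generated graded $S$-module $M$ with graded Betti numbers $\beta_{i,j}(M)$, the Castelnuovo--Mumford regularity is $\mathrm{reg}(M)=\max\{j-i : \beta_{i,j}(M)\neq 0\}$. *)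

theory Defs
  imports
    "HOL-Library.Poly_Mapping"
    "HOL-Library.Cardinality"
    "HOL-Library.Disjoint_Sets"
    "HOL-Library.Extended_Real"
    "Jordan_Normal_Form.Matrix"
begin

section \<open>Graphs and matchings\<close>

text \<open>
  The vertex set of a graph is the whole finite type of the vertices, so that a graph is given by
  its edge set, and the number of vertices is the cardinality of the type.
\<close>

definition simple_graph :: "'v set set \<Rightarrow> bool" where
  "simple_graph E \<longleftrightarrow> (\<forall>e\<in>E. card e = 2)"

definition matching :: "'v set set \<Rightarrow> 'v set set \<Rightarrow> bool" where
  "matching E M \<longleftrightarrow> M \<subseteq> E \<and> disjoint M"

definition match_number :: "'v::finite set set \<Rightarrow> nat" where
  "match_number E = Max (card ` {M. matching E M})"


section \<open>Polynomials and ideals\<close>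

text \<open>
  Polynomials are finitely supported maps from exponent vectors to coefficients. For a finite type
  of variables this is the polynomial ring $S$ in as many variables as the type has elements; the
  product of such maps is convolution.
\<close>

type_synonym ('v, 'k) mpoly = "('v \<Rightarrow>\<^sub>0 nat) \<Rightarrow>\<^sub>0 'k"

definition var :: "'v \<Rightarrow> ('v, 'k::comm_ring_1) mpoly" where
  "var x = Poly_Mapping.single (Poly_Mapping.single x 1) 1"

definition mdegree :: "('v \<Rightarrow>\<^sub>0 nat) \<Rightarrow> nat" where
  "mdegree m = (\<Sum>x\<in>Poly_Mapping.keys m. Poly_Mapping.lookup m x)"

text \<open>
  The zero polynomial is homogeneous of every degree, and it is the only homogeneous polynomial of
  negative degree.
\<close>

definition homogeneous :: "int \<Rightarrow> ('v, 'k::comm_ring_1) mpoly \<Rightarrow> bool" where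
  "homogeneous d p \<longleftrightarrow> (\<forall>m\<in>Poly_Mapping.keys p. int (mdegree m) = d)"

definition ideal_gen :: "'r::comm_ring_1 set \<Rightarrow> 'r set" where
  "ideal_gen B = Modules.module.span (*) B"

definition irrelevant_ideal :: "('v, 'k::comm_ring_1) mpoly set" where
  "irrelevant_ideal = ideal_gen (range var)"

definition ideal_power :: "'r::comm_ring_1 set \<Rightarrow> nat \<Rightarrow> 'r set" where
  "ideal_power I s = ideal_gen {\<Prod>i<s. f i | f. \<forall>i<s. f i \<in> I}"

definition squarefree_monomial :: "('v::finite, 'k::comm_ring_1) mpoly \<Rightarrow> bool" where
  "squarefree_monomial p \<longleftrightarrow> (\<exists>A. p = (\<Prod>x\<in>A. var x))"

definition squarefree_power ::
    "('v::finite, 'k::comm_ring_1) mpoly set \<Rightarrow> nat \<Rightarrow> ('v, 'k) mpoly set" where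
  "squarefree_power I s = ideal_gen {p \<in> ideal_power I s. squarefree_monomial p}"

definition edge_ideal :: "'v set set \<Rightarrow> ('v, 'k::comm_ring_1) mpoly set" where
  "edge_ideal E = ideal_gen {var x * var y | x y. {x, y} \<in> E}"


section \<open>Minimal graded free resolutions, Betti numbers and regularity\<close>

text \<open>
  A graded free resolution
  $\cdots \to F_2 \to F_1 \to F_0 \to I \to 0$ of a homogeneous ideal $I$ of $S$ is encoded by the
  shifts and the matrices of its maps: $F_i = \bigoplus_b S(-d_b)$ where $d_b$ runs through the
  list \<open>sh i\<close>; \<open>D 0\<close> is the row of the images in $I \subseteq S$ of the basis of $F_0$, and
  \<open>D (Suc i)\<close> is the matrix of $F_{i+1} \to F_i$. The maps have degree $0$ for the gradings. The
  resolution is minimal if $F_{i+1}$ is mapped into $\mathfrak m F_i$ for every $i$, where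
  $\mathfrak m$ is \<open>irrelevant_ideal\<close>.
\<close>

definition minimal_graded_free_resolution ::
    "('v, 'k::comm_ring_1) mpoly set \<Rightarrow> (nat \<Rightarrow> int list) \<Rightarrow> (nat \<Rightarrow> ('v, 'k) mpoly mat) \<Rightarrow> bool"
  where
  "minimal_graded_free_resolution I sh D \<longleftrightarrow>
     D 0 \<in> carrier_mat 1 (length (sh 0)) \<and>
     (\<forall>i. D (Suc i) \<in> carrier_mat (length (sh i)) (length (sh (Suc i)))) \<and>
     (\<forall>b<length (sh 0). homogeneous (sh 0 ! b) (D 0 $$ (0, b))) \<and>
     (\<forall>i. \<forall>a<length (sh i). \<forall>b<length (sh (Suc i)).
        homogeneous (sh (Suc i) ! b - sh i ! a) (D (Suc i) $$ (a, b))) \<and>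
     {(D 0 *\<^sub>v u) $ 0 | u. u \<in> carrier_vec (length (sh 0))} = I \<and>
     (\<forall>i. {D (Suc i) *\<^sub>v w | w. w \<in> carrier_vec (length (sh (Suc i)))} =
          {u \<in> carrier_vec (length (sh i)). D i *\<^sub>v u = 0\<^sub>v (dim_row (D i))}) \<and>
     (\<forall>i. \<forall>a<length (sh i). \<forall>b<length (sh (Suc i)).
        D (Suc i) $$ (a, b) \<in> irrelevant_ideal)"

text \<open>
  The number of summands $S(-j)$ of $F_i$. A homogeneous ideal in finitely many variables over a
  field has a minimal graded free resolution, which is unique up to isomorphism, so that the choice
  is immaterial; the value $0$ is a default for sets that have no such resolution.
\<close>

definition graded_betti :: "('v, 'k::comm_ring_1) mpoly set \<Rightarrow> nat \<Rightarrow> int \<Rightarrow> nat" where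
  "graded_betti I i j =
     (if \<exists>sh D. minimal_graded_free_resolution I sh D
      then count_list ((SOME sh. \<exists>D. minimal_graded_free_resolution I sh D) i) j
      else 0)"

text \<open>
  The supremum is taken in the extended reals, so that no finiteness has to be known beforehand. It
  is a maximum when $I$ is a nonzero homogeneous ideal over a field: then the set of pairs $(i, j)$
  with a nonzero graded Betti number is finite and nonempty.
\<close>

definition regularity :: "('v, 'k::comm_ring_1) mpoly set \<Rightarrow> ereal" where
  "regularity I =
     (SUP (i, j) \<in> {(i, j). graded_betti I i j \<noteq> 0}. ereal (real_of_int (j - int i)))"

end

theory Submission
  imports Defs "HOL-Library.Countable"
begin

text \<open>
  It suffices to see that a shift \<open>j\<close> in homological degree \<open>i\<close> of a minimal resolution of
  $I(G)^{[s]}$ satisfies \<open>j \<le> 2s + 2i\<close> and \<open>j \<le> n\<close>, because then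
  \<open>2(j - i) \<le> 2s + j \<le> 2s + n\<close>. Since Tor can be computed from the Koszul complex, these shifts
  are degrees of nonvanishing Koszul homology of $I(G)^{[s]}$. In a squarefree multidegree \<open>W\<close>,
  this is the reduced homology, in dimension \<open>i - 1\<close>, of the simplicial complex of the sets
  \<open>\<sigma> \<subseteq> W\<close> for which \<open>G[W - \<sigma>]\<close> has a matching of size \<open>s\<close>; in the other multidegrees the
  complex is a cone.

  The simplicial complex has no homology in dimension \<open>i - 1\<close> when \<open>2i + 2s < |W|\<close>. The vertex
  sets of matchings form an even delta-matroid, and the induction runs over even delta-matroids that
  contain the empty set. Choose a feasible pair \<open>{x, y}\<close>; the links of \<open>x\<close>, and of \<open>y\<close> in the
  deletion of \<open>x\<close>, have a smaller ground set, and deleting both \<open>x\<close> and \<open>y\<close> gives the complex of the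
  contraction of \<open>{x, y}\<close>, with \<open>s\<close> replaced by \<open>s - 1\<close>.
\<close>

section \<open>Simplicial homology\<close>

text \<open>Incidence sign of \<open>x\<close> in \<open>insert x \<sigma>\<close>. The vertex type
  carries no order, so one is borrowed from the injection \<open>to_nat\<close>.\<close>

definition sg :: "'v::finite \<Rightarrow> 'v set \<Rightarrow> 'a::comm_ring_1" where
  "sg x \<sigma> = (if even (card {y\<in>\<sigma>. to_nat y < to_nat x}) then 1 else - 1)"

lemma sg_square [simp]: "sg x \<sigma> * sg x \<sigma> = (1 :: 'a::comm_ring_1)"
  by (simp add: sg_def)

lemma sg_square_left [simp]: "sg x \<sigma> * (sg x \<sigma> * a) = (a :: 'a::comm_ring_1)"
  by (simp add: sg_def)

lemma sg_swap:
  assumes "x \<noteq> y" "x \<notin> \<sigma>" "y \<notin> \<sigma>"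
  shows "sg y (insert x \<sigma>) * sg x (insert y \<sigma>) = - (sg x \<sigma> * sg y \<sigma> :: 'a::comm_ring_1)"
proof -
  have ins: "card {z\<in>insert a \<sigma>. to_nat z < to_nat b} =
      card {z\<in>\<sigma>. to_nat z < to_nat b} + (if to_nat a < to_nat b then 1 else 0)"
    if "a \<notin> \<sigma>" for a b
  proof -
    have "{z\<in>insert a \<sigma>. to_nat z < to_nat b} =
        (if to_nat a < to_nat b then insert a else id) {z\<in>\<sigma>. to_nat z < to_nat b}"
      by auto
    then show ?thesis using that by simp
  qed
  have "to_nat x < to_nat y \<or> to_nat y < to_nat x"
    using assms(1) by (metis linorder_neqE_nat to_nat_split)
  then show ?thesis
    unfolding sg_def ins[OF assms(2)] ins[OF assms(3)] by auto
qed

text \<open>Given by its coefficient at \<open>\<sigma>\<close>, to which every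
  \<open>insert x \<sigma>\<close> contributes. The empty set counts as a face, so the complex is
  augmented.\<close>

definition boundary :: "('v::finite set \<Rightarrow> 'a::comm_ring_1) \<Rightarrow> 'v set \<Rightarrow> 'a" where
  "boundary c \<sigma> = (\<Sum>x\<in>-\<sigma>. sg x \<sigma> * c (insert x \<sigma>))"

definition chain_on :: "'v set set \<Rightarrow> nat \<Rightarrow> ('v set \<Rightarrow> 'a::zero) \<Rightarrow> bool" where
  "chain_on \<Delta> i c \<longleftrightarrow> (\<forall>\<sigma>. c \<sigma> \<noteq> 0 \<longrightarrow> \<sigma> \<in> \<Delta> \<and> card \<sigma> = i)"

text \<open>The index \<open>i\<close> counts vertices: this concerns reduced homology in dimension
  \<open>i - 1\<close>. The type argument fixes the coefficient ring.\<close>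

definition acyclic_at :: "'a::comm_ring_1 itself \<Rightarrow> 'v::finite set set \<Rightarrow> nat \<Rightarrow> bool" where
  "acyclic_at _ \<Delta> i \<longleftrightarrow> (\<forall>c :: 'v set \<Rightarrow> 'a. chain_on \<Delta> i c \<longrightarrow> (\<forall>\<sigma>. boundary c \<sigma> = 0) \<longrightarrow>
     (\<exists>u. chain_on \<Delta> (Suc i) u \<and> boundary u = c))"

text \<open>\<open>l\<close> is the part of \<open>c\<close> through \<open>x\<close>, read as a
  chain of the link. By \<open>sg_swap\<close>, passing to the link commutes with the boundary up to
  sign.\<close>

lemma boundary_insert:
  fixes c :: "'v::finite set \<Rightarrow> 'a::comm_ring_1"
  assumes "x \<notin> \<tau>"
  defines "l \<equiv> \<lambda>\<tau>. if x \<in> \<tau> then 0 else sg x \<tau> * c (insert x \<tau>)"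
  shows "boundary c (insert x \<tau>) = - (sg x \<tau> * boundary l \<tau>)"
proof -
  have "boundary l \<tau> = (\<Sum>y\<in>-\<tau>. sg y \<tau> * l (insert y \<tau>))"
    by (simp add: boundary_def)
  also have "\<dots> = (\<Sum>y\<in>-insert x \<tau>. sg y \<tau> * l (insert y \<tau>))"
    by (rule sum.mono_neutral_right) (auto simp: l_def)
  finally have "- (sg x \<tau> * boundary l \<tau>)
      = (\<Sum>y\<in>-insert x \<tau>. - (sg x \<tau> * sg y \<tau>) * l (insert y \<tau>))"
    by (simp add: sum_distrib_left sum_negf mult.assoc)
  also have "\<dots> = (\<Sum>y\<in>-insert x \<tau>. sg y (insert x \<tau>) * c (insert y (insert x \<tau>)))"
  proof (rule sum.cong)
    fix y assume y: "y \<in> - insert x \<tau>"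
    then have "sg y (insert x \<tau>) * sg x (insert y \<tau>) = - (sg x \<tau> * sg y \<tau> :: 'a)"
      using assms(1) by (intro sg_swap) auto
    then have "- (sg x \<tau> * sg y \<tau>) * l (insert y \<tau>) =
        sg y (insert x \<tau>) * (sg x (insert y \<tau>) * l (insert y \<tau>))"
      by (metis mult.assoc)
    also have "sg x (insert y \<tau>) * l (insert y \<tau>) = c (insert y (insert x \<tau>))"
      using y assms(1) by (auto simp: l_def insert_commute)
    finally show "- (sg x \<tau> * sg y \<tau>) * l (insert y \<tau>) =
        sg y (insert x \<tau>) * c (insert y (insert x \<tau>))" .
  qed simp
  finally show ?thesis by (simp add: boundary_def)
qed

text \<open>Terms cancel in pairs. In characteristic two antisymmetry says nothing about the
  diagonal, hence the separate assumption on \<open>f x x\<close>.\<close>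

lemma sum_sum_antisymmetric:
  fixes f :: "'b \<Rightarrow> 'b \<Rightarrow> 'a::ab_group_add"
  assumes "finite A" "\<And>x. f x x = 0" "\<And>x y. x \<in> A \<Longrightarrow> y \<in> A \<Longrightarrow> f x y = - f y x"
  shows "(\<Sum>x\<in>A. \<Sum>y\<in>A. f x y) = 0"
  using assms(1,3)
proof (induction A)
  case (insert a A)
  have "(\<Sum>x\<in>A. f x a) = (\<Sum>x\<in>A. - f a x)"
    by (intro sum.cong refl insert.prems) auto
  moreover have "(\<Sum>x\<in>A. \<Sum>y\<in>A. f x y) = 0"
    by (intro insert.IH insert.prems) auto
  ultimately show ?case
    using insert.hyps by (simp add: assms(2) sum.distrib sum_negf)
qed simp

text \<open>The two orders of removing \<open>x\<close> and \<open>y\<close> carry opposite signs. A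
  zero diagonal lets both sums run over all of \<open>- \<sigma>\<close>.\<close>

lemma boundary_boundary: "boundary (boundary c) \<sigma> = (0 :: 'a::comm_ring_1)"
proof -
  define f where "f x y = (if x = y then 0
    else sg x \<sigma> * (sg y (insert x \<sigma>) * c (insert y (insert x \<sigma>))))" for x y
  have antisym: "f x y = - f y x" if "x \<in> -\<sigma>" "y \<in> -\<sigma>" for x y
  proof (cases "x = y")
    case False
    then have "sg y (insert x \<sigma>) * sg x (insert y \<sigma>) = - (sg x \<sigma> * sg y \<sigma> :: 'a)"
      using that by (intro sg_swap) auto
    then have "sg x \<sigma> * sg y (insert x \<sigma>) = - (sg y \<sigma> * sg x (insert y \<sigma>) :: 'a)"
      by (auto simp: sg_def split: if_splits)
    then have "sg x \<sigma> * sg y (insert x \<sigma>) * c (insert y (insert x \<sigma>)) =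
        - (sg y \<sigma> * sg x (insert y \<sigma>) * c (insert x (insert y \<sigma>)))"
      by (simp add: insert_commute)
    then show ?thesis using False by (simp add: f_def mult.assoc)
  qed (simp add: f_def)
  have "(\<Sum>x\<in>-\<sigma>. \<Sum>y\<in>-\<sigma>. f x y) = 0"
    by (rule sum_sum_antisymmetric[OF finite _ antisym]) (simp add: f_def)
  moreover have "boundary (boundary c) \<sigma> = (\<Sum>x\<in>-\<sigma>. \<Sum>y\<in>-\<sigma>. f x y)"
    unfolding boundary_def sum_distrib_left
  proof (rule sum.cong)
    fix x assume "x \<in> -\<sigma>"
    have "(\<Sum>y\<in>-insert x \<sigma>. sg x \<sigma> * (sg y (insert x \<sigma>) * c (insert y (insert x \<sigma>)))) =
        (\<Sum>y\<in>-insert x \<sigma>. f x y)"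
      by (rule sum.cong) (auto simp: f_def)
    also have "\<dots> = (\<Sum>y\<in>-\<sigma>. f x y)"
      by (rule sum.mono_neutral_left) (auto simp: f_def)
    finally show "(\<Sum>y\<in>-insert x \<sigma>. sg x \<sigma> * (sg y (insert x \<sigma>) * c (insert y (insert x \<sigma>)))) =
        (\<Sum>y\<in>-\<sigma>. f x y)" .
  qed simp
  ultimately show ?thesis by simp
qed

section \<open>Linearity of the boundary, and cones\<close>

lemma boundary_diff:
  "boundary (\<lambda>\<sigma>. c \<sigma> - d \<sigma>) \<sigma> = boundary c \<sigma> - boundary d \<sigma>"
  by (simp add: boundary_def sum_subtractf right_diff_distrib)

lemma boundary_add:
  "boundary (\<lambda>\<sigma>. c \<sigma> + d \<sigma>) \<sigma> = boundary c \<sigma> + boundary d \<sigma>"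
  by (simp add: boundary_def sum.distrib distrib_left)

text \<open>Join with the vertex \<open>x\<close>. Only the values of \<open>u\<close> on sets
  without \<open>x\<close> enter.\<close>

definition cone :: "'v::finite \<Rightarrow> ('v set \<Rightarrow> 'a::comm_ring_1) \<Rightarrow> 'v set \<Rightarrow> 'a" where
  "cone x u \<sigma> = (if x \<in> \<sigma> then sg x (\<sigma> - {x}) * u (\<sigma> - {x}) else 0)"

lemma boundary_cone_notin:
  assumes "x \<notin> \<sigma>"
  shows "boundary (cone x u) \<sigma> = u \<sigma>"
proof -
  have "boundary (cone x u) \<sigma> = (\<Sum>y\<in>{x}. sg y \<sigma> * cone x u (insert y \<sigma>))"
    unfolding boundary_def
    by (rule sum.mono_neutral_right) (use assms in \<open>auto simp: cone_def\<close>)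
  then show ?thesis using assms by (simp add: cone_def)
qed

lemma boundary_cone_insert:
  assumes "x \<notin> \<tau>"
  shows "boundary (cone x u) (insert x \<tau>) =
    - (sg x \<tau> * boundary (\<lambda>\<sigma>. if x \<in> \<sigma> then 0 else u \<sigma>) \<tau>)"
proof -
  have "(\<lambda>\<sigma>. if x \<in> \<sigma> then 0 else sg x \<sigma> * cone x u (insert x \<sigma>)) =
      (\<lambda>\<sigma>. if x \<in> \<sigma> then 0 else u \<sigma>)"
    by (auto simp: cone_def fun_eq_iff)
  then show ?thesis using boundary_insert[OF assms, of "cone x u"] by simp
qed

text \<open>Coning is a contracting homotopy. On sets through \<open>x\<close> the cycle condition
  is used: the parts of \<open>c\<close> with and without \<open>x\<close> have opposite
  boundaries.\<close>

lemma boundary_cone_cycle: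
  fixes c :: "'v::finite set \<Rightarrow> 'a::comm_ring_1"
  assumes "\<And>\<sigma>. boundary c \<sigma> = 0"
  shows "boundary (cone x c) = c"
proof
  fix \<sigma>
  show "boundary (cone x c) \<sigma> = c \<sigma>"
  proof (cases "x \<in> \<sigma>")
    case False
    then show ?thesis by (rule boundary_cone_notin)
  next
    case True
    define \<tau> where "\<tau> = \<sigma> - {x}"
    have \<tau>: "x \<notin> \<tau>" "\<sigma> = insert x \<tau>" using True by (auto simp: \<tau>_def)
    have "boundary (\<lambda>\<sigma>. if x \<in> \<sigma> then 0 else c \<sigma>) \<tau> =
        boundary (\<lambda>\<sigma>. c \<sigma> - (if x \<in> \<sigma> then c \<sigma> else 0)) \<tau>"
      by (rule arg_cong[where f = "\<lambda>f. boundary f \<tau>"]) auto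
    also have "\<dots> = - boundary (\<lambda>\<sigma>. if x \<in> \<sigma> then c \<sigma> else 0) \<tau>"
      by (simp add: boundary_diff assms)
    also have "boundary (\<lambda>\<sigma>. if x \<in> \<sigma> then c \<sigma> else 0) \<tau> =
        (\<Sum>y\<in>{x}. sg y \<tau> * (if x \<in> insert y \<tau> then c (insert y \<tau>) else 0))"
      unfolding boundary_def by (rule sum.mono_neutral_right) (use \<tau> in auto)
    finally show ?thesis
      using boundary_cone_insert[OF \<tau>(1), of c] by (simp add: \<tau>(2))
  qed
qed

lemma chain_on_cone:
  fixes u :: "'v::finite set \<Rightarrow> 'a::comm_ring_1"
  assumes "chain_on \<Lambda> i u" "\<And>\<tau>. \<tau> \<in> \<Lambda> \<Longrightarrow> insert x \<tau> \<in> \<Delta>"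
  shows "chain_on \<Delta> (Suc i) (cone x u)"
  unfolding chain_on_def
proof (intro allI impI)
  fix \<sigma> assume "cone x u \<sigma> \<noteq> 0"
  then have "x \<in> \<sigma>" "u (\<sigma> - {x}) \<noteq> 0" by (auto simp: cone_def split: if_splits)
  then have "\<sigma> - {x} \<in> \<Lambda>" "card (\<sigma> - {x}) = i" "insert x (\<sigma> - {x}) = \<sigma>"
    using assms(1) by (auto simp: chain_on_def)
  then show "\<sigma> \<in> \<Delta> \<and> card \<sigma> = Suc i"
    using assms(2) \<open>x \<in> \<sigma>\<close> by (metis card.remove finite_class.finite)
qed

lemma acyclic_at_cone:
  assumes "\<And>\<sigma>. \<sigma> \<in> \<Delta> \<Longrightarrow> insert x \<sigma> \<in> \<Delta>"
  shows "acyclic_at TYPE('a::comm_ring_1) \<Delta> i"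
  unfolding acyclic_at_def
proof (intro allI impI)
  fix c :: "_ \<Rightarrow> 'a"
  assume "chain_on \<Delta> i c" "\<forall>\<sigma>. boundary c \<sigma> = 0"
  then show "\<exists>u. chain_on \<Delta> (Suc i) u \<and> boundary u = c"
    using chain_on_cone[OF _ assms, where u = c] boundary_cone_cycle[of c x] by blast
qed

text \<open>
  The part of the long exact sequence of the pair (complex, deletion of \<open>x\<close>) that is needed; the
  relative homology is the homology of the link, one degree lower.
\<close>

lemma acyclic_at_link_deletion:
  fixes \<Delta> :: "'v::finite set set"
  assumes down: "\<And>\<tau>. insert x \<tau> \<in> \<Delta> \<Longrightarrow> \<tau> \<in> \<Delta>"
    and del: "acyclic_at TYPE('a::comm_ring_1) {\<sigma>\<in>\<Delta>. x \<notin> \<sigma>} i"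
    and link: "\<And>k. i = Suc k \<Longrightarrow>
      acyclic_at TYPE('a) {\<sigma>. x \<notin> \<sigma> \<and> insert x \<sigma> \<in> \<Delta>} k"
  shows "acyclic_at TYPE('a) \<Delta> i"
  unfolding acyclic_at_def
proof (intro allI impI)
  fix c :: "_ \<Rightarrow> 'a"
  assume c: "chain_on \<Delta> i c" and cyc: "\<forall>\<sigma>. boundary c \<sigma> = 0"
  define \<Lambda> where "\<Lambda> = {\<sigma>. x \<notin> \<sigma> \<and> insert x \<sigma> \<in> \<Delta>}"
  define l where "l = (\<lambda>\<tau>. if x \<in> \<tau> then 0 else sg x \<tau> * c (insert x \<tau>))"
  \<comment> \<open>\<open>l\<close> is a cycle of the link one degree lower; for
    \<open>i = 0\<close> there is no lower degree and \<open>l\<close> vanishes.\<close>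
  have "\<exists>u. chain_on \<Lambda> i u \<and> boundary u = l"
  proof (cases i)
    case 0
    then have "l = (\<lambda>_. 0)"
      using c unfolding chain_on_def l_def fun_eq_iff
      by (metis card_eq_0_iff finite_class.finite insert_not_empty mult_zero_right)
    then show ?thesis
      by (intro exI[of _ "\<lambda>_. 0"]) (auto simp: chain_on_def boundary_def)
  next
    case (Suc k)
    have "chain_on \<Lambda> k l"
      using c Suc unfolding chain_on_def l_def \<Lambda>_def
      by (auto split: if_splits) (metis card_insert_disjoint diff_Suc_1 finite_class.finite mult_zero_right)+
    moreover have "boundary l \<tau> = 0" for \<tau>
    proof (cases "x \<in> \<tau>")
      case True
      then show ?thesis by (auto simp: boundary_def l_def)
    next
      case False
      have "sg x \<tau> * boundary l \<tau> = 0"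
        using boundary_insert[OF False, of c] cyc unfolding l_def by simp
      then show ?thesis by (metis sg_square_left mult_zero_right)
    qed
    ultimately show ?thesis
      using link[OF Suc] Suc unfolding acyclic_at_def \<Lambda>_def by blast
  qed
  then obtain u where u: "chain_on \<Lambda> i u" "boundary u = l" by blast
  \<comment> \<open>The boundary of the cone over \<open>u\<close> cancels \<open>c\<close> on the
    sets through \<open>x\<close>, so \<open>c'\<close> is a cycle of the deletion homologous to
    \<open>c\<close>.\<close>
  define c' where "c' = (\<lambda>\<sigma>. c \<sigma> + boundary (cone x u) \<sigma>)"
  have u0: "(\<lambda>\<sigma>. if x \<in> \<sigma> then 0 else u \<sigma>) = u"
    using u(1) by (auto simp: chain_on_def \<Lambda>_def fun_eq_iff)
  have cx: "c' \<sigma> = 0" if "x \<in> \<sigma>" for \<sigma>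
  proof -
    define \<tau> where "\<tau> = \<sigma> - {x}"
    have \<tau>: "x \<notin> \<tau>" "\<sigma> = insert x \<tau>" using that by (auto simp: \<tau>_def)
    show ?thesis
      using boundary_cone_insert[OF \<tau>(1), of u] \<tau>(1)
      by (simp add: c'_def u0 u(2) \<tau>(2) l_def)
  qed
  have "chain_on {\<sigma>\<in>\<Delta>. x \<notin> \<sigma>} i c'"
    unfolding chain_on_def
  proof (intro allI impI)
    fix \<sigma> assume *: "c' \<sigma> \<noteq> 0"
    then have x: "x \<notin> \<sigma>" using cx by blast
    then have "c' \<sigma> = c \<sigma> + u \<sigma>" by (simp add: c'_def boundary_cone_notin)
    with * have "c \<sigma> \<noteq> 0 \<or> u \<sigma> \<noteq> 0" by auto
    then show "\<sigma> \<in> {\<sigma>\<in>\<Delta>. x \<notin> \<sigma>} \<and> card \<sigma> = i"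
      using x c u(1) down by (auto simp: chain_on_def \<Lambda>_def)
  qed
  moreover have "boundary c' \<sigma> = 0" for \<sigma>
    using cyc by (simp add: c'_def boundary_add boundary_boundary)
  ultimately obtain v where v: "chain_on {\<sigma>\<in>\<Delta>. x \<notin> \<sigma>} (Suc i) v" "boundary v = c'"
    using del unfolding acyclic_at_def by blast
  have "chain_on \<Delta> (Suc i) (\<lambda>\<sigma>. v \<sigma> - cone x u \<sigma>)"
    using v(1) chain_on_cone[OF u(1), of x \<Delta>] unfolding chain_on_def \<Lambda>_def
    by (smt (verit) diff_self mem_Collect_eq)
  moreover have "boundary (\<lambda>\<sigma>. v \<sigma> - cone x u \<sigma>) = c"
    using v(2) by (auto simp: boundary_diff fun_eq_iff c'_def)
  ultimately show "\<exists>u. chain_on \<Delta> (Suc i) u \<and> boundary u = c" by blast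
qed

section \<open>Even delta-matroids\<close>

text \<open>Requiring \<open>y \<noteq> x\<close> makes the delta-matroid even: each exchange
  shrinks the symmetric difference to \<open>B\<close> by two, so on a finite ground set all
  feasible sets have the same parity.\<close>

definition even_delta_matroid :: "'v set set \<Rightarrow> bool" where
  "even_delta_matroid F \<longleftrightarrow> {} \<in> F \<and>
     (\<forall>A\<in>F. \<forall>B\<in>F. \<forall>x\<in>sym_diff A B. \<exists>y\<in>sym_diff A B. y \<noteq> x \<and> sym_diff A {x, y} \<in> F)"

lemma even_delta_matroidD:
  assumes "even_delta_matroid F" "A \<in> F" "B \<in> F" "x \<in> sym_diff A B"
  obtains y where "y \<in> sym_diff A B" "y \<noteq> x" "sym_diff A {x, y} \<in> F"
  using assms unfolding even_delta_matroid_def by blast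

definition contract :: "'v \<Rightarrow> 'v \<Rightarrow> 'v set set \<Rightarrow> 'v set set" where
  "contract x y F = {A. x \<notin> A \<and> y \<notin> A \<and> insert x (insert y A) \<in> F}"

text \<open>Adding \<open>x\<close> and \<open>y\<close> to both sets leaves their symmetric
  difference unchanged, so the exchanges in \<open>F\<close> avoid the pair.\<close>

lemma even_delta_matroid_contract:
  assumes F: "even_delta_matroid F" and xy: "{x, y} \<in> F"
  shows "even_delta_matroid (contract x y F)"
  unfolding even_delta_matroid_def
proof (intro conjI ballI)
  show "{} \<in> contract x y F" using xy by (simp add: contract_def)
  fix A B z
  assume A: "A \<in> contract x y F" and B: "B \<in> contract x y F" and z: "z \<in> sym_diff A B"
  let ?A = "insert x (insert y A)" and ?B = "insert x (insert y B)"
  have eq: "sym_diff ?A ?B = sym_diff A B"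
    using A B by (auto simp: contract_def)
  obtain w where w: "w \<in> sym_diff A B" "w \<noteq> z" "sym_diff ?A {z, w} \<in> F"
    using even_delta_matroidD[OF F, of ?A ?B z] A B z unfolding eq
    by (auto simp: contract_def)
  have ne: "z \<noteq> x" "z \<noteq> y" "w \<noteq> x" "w \<noteq> y"
    using A B z w(1) by (auto simp: contract_def)
  have "insert x (insert y (sym_diff A {z, w})) = sym_diff ?A {z, w}"
    using ne by auto
  then have "sym_diff A {z, w} \<in> contract x y F"
    using A w(3) ne by (simp add: contract_def)
  then show "\<exists>w\<in>sym_diff A B. w \<noteq> z \<and> sym_diff A {z, w} \<in> contract x y F"
    using w by blast
qed

text \<open>An exchange toward \<open>{x, y}\<close> at \<open>x\<close> adds \<open>x\<close> and
  either drops an element outside the pair or adds \<open>y\<close> too. The size never falls, and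
  the second exchange, at \<open>y\<close>, cannot lose \<open>x\<close>.\<close>

lemma extend_feasible_pair:
  fixes F :: "'v::finite set set"
  assumes F: "even_delta_matroid F" and xy: "{x, y} \<in> F" "x \<in> U" "y \<in> U"
    and A: "A \<in> F" "A \<subseteq> U" "k \<le> card A"
  obtains B where "B \<in> F" "B \<subseteq> U" "k \<le> card B" "x \<in> B" "y \<in> B"
proof -
  have step: "\<exists>B\<in>F. B \<subseteq> U \<and> k \<le> card B \<and> x \<in> B \<and> (y \<in> A \<longrightarrow> y \<in> B)"
    if xy: "{x, y} \<in> F" "x \<in> U" "y \<in> U" and A: "A \<in> F" "A \<subseteq> U" "k \<le> card A"
    for x y A
  proof (cases "x \<in> A")
    case True
    then show ?thesis using A by blast
  next
    case False
    obtain z where z: "z \<in> sym_diff A {x, y}" "z \<noteq> x" "sym_diff A {x, z} \<in> F"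
      using even_delta_matroidD[OF F A(1) xy(1), of x] False by blast
    have zU: "sym_diff A {x, z} \<subseteq> U" using z A xy by auto
    have "card A \<le> card (sym_diff A {x, z})"
    proof (cases "z \<in> A")
      case True
      then have "sym_diff A {x, z} = insert x (A - {z})" using False z by auto
      then have "card (sym_diff A {x, z}) = Suc (card (A - {z}))" using False by simp
      also have "\<dots> = card A" using True by (metis card.remove finite_class.finite)
      finally show ?thesis by simp
    next
      case z': False
      then have "sym_diff A {x, z} = insert x (insert z A)" using False by auto
      then show ?thesis by (simp add: card_mono subset_insertI2)
    qed
    then show ?thesis
      using z zU A(3) False by (intro bexI[of _ "sym_diff A {x, z}"]) auto
  qed
  from step[OF xy A] obtain B where B: "B \<in> F" "B \<subseteq> U" "k \<le> card B" "x \<in> B" by blast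
  have yx: "{y, x} \<in> F" using xy(1) by (simp add: insert_commute)
  from step[OF yx xy(3,2) B(1-3)] B(4) that show thesis by blast
qed

text \<open>If \<open>F\<close> consists of the vertex sets of matchings, the condition asks for a
  matching of size at least \<open>s\<close> inside \<open>W - \<sigma>\<close>.\<close>

definition avoiding :: "'v set set \<Rightarrow> 'v set \<Rightarrow> nat \<Rightarrow> 'v set set" where
  "avoiding F W s = {\<sigma>. \<sigma> \<subseteq> W \<and> (\<exists>A\<in>F. A \<subseteq> W - \<sigma> \<and> 2 * s \<le> card A)}"

lemma avoiding_subset: "\<tau> \<in> avoiding F W s" if "\<sigma> \<in> avoiding F W s" "\<tau> \<subseteq> \<sigma>"
  using that unfolding avoiding_def by blast

lemma avoiding_0: "avoiding F W 0 = Pow W" if "even_delta_matroid F"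
  using that unfolding avoiding_def even_delta_matroid_def by auto

text \<open>A face missing \<open>x\<close> and \<open>y\<close> leaves both in its complement,
  where \<open>extend_feasible_pair\<close> makes the feasible set contain them. Removing the pair
  costs two elements, that is, one unit of \<open>s\<close>.\<close>

lemma avoiding_contract:
  fixes F :: "'v::finite set set"
  assumes F: "even_delta_matroid F" and xy: "{x, y} \<in> F" "x \<in> W" "y \<in> W" "x \<noteq> y"
  shows "{\<sigma>\<in>avoiding F W (Suc s). x \<notin> \<sigma> \<and> y \<notin> \<sigma>} = avoiding (contract x y F) (W - {x, y}) s"
    (is "?L = ?R")
proof (intro equalityI subsetI)
  fix \<sigma> assume \<sigma>: "\<sigma> \<in> ?L"
  then obtain A where A: "A \<in> F" "A \<subseteq> W - \<sigma>" "2 * Suc s \<le> card A"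
    by (auto simp: avoiding_def)
  obtain B where B: "B \<in> F" "B \<subseteq> W - \<sigma>" "2 * Suc s \<le> card B" "x \<in> B" "y \<in> B"
    using extend_feasible_pair[OF F xy(1) _ _ A] xy \<sigma> by auto
  have eq: "insert x (insert y (B - {x, y})) = B" using B by blast
  have "card (B - {x, y}) = card B - 2" 
    using B xy(4) by (subst card_Diff_subset) auto
  then have "B - {x, y} \<in> contract x y F" "2 * s \<le> card (B - {x, y})"
    using B eq by (auto simp: contract_def)
  moreover have "B - {x, y} \<subseteq> W - {x, y} - \<sigma>" using B by blast
  ultimately show "\<sigma> \<in> ?R" using \<sigma> unfolding avoiding_def by blast
next
  fix \<sigma> assume \<sigma>: "\<sigma> \<in> ?R"
  then obtain A where A: "A \<in> contract x y F" "A \<subseteq> W - {x, y} - \<sigma>" "2 * s \<le> card A"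
    by (auto simp: avoiding_def)
  let ?B = "insert x (insert y A)"
  have "?B \<in> F" "2 * Suc s \<le> card ?B" using A xy(4) by (auto simp: contract_def)
  moreover have "?B \<subseteq> W - \<sigma>" using A xy \<sigma> by (auto simp: avoiding_def)
  ultimately show "\<sigma> \<in> ?L" using \<sigma> unfolding avoiding_def by blast
qed

lemma avoiding_link:
  assumes "x \<in> W"
  shows "{\<sigma>. x \<notin> \<sigma> \<and> insert x \<sigma> \<in> avoiding F W s} = avoiding F (W - {x}) s"
proof -
  have *: "x \<notin> \<sigma> \<and> insert x \<sigma> \<subseteq> W \<longleftrightarrow> \<sigma> \<subseteq> W - {x}" "W - {x} - \<sigma> = W - insert x \<sigma>" for \<sigma>
    using assms by auto
  show ?thesis
    unfolding avoiding_def mem_Collect_eq conj_assoc[symmetric] *(1) *(2) ..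
qed

text \<open>No feasible subset of \<open>W\<close> uses such a loop \<open>x\<close>, so every face
  can absorb it.\<close>

lemma avoiding_loop:
  assumes "\<And>A. A \<in> F \<Longrightarrow> A \<subseteq> W \<Longrightarrow> x \<notin> A" and "x \<in> W"
  shows "{\<sigma>\<in>avoiding F W s. x \<notin> \<sigma>} = avoiding F (W - {x}) s"
    and "\<sigma> \<in> avoiding F W s \<Longrightarrow> insert x \<sigma> \<in> avoiding F W s"
proof -
  have sub: "A \<subseteq> W - \<sigma> \<longleftrightarrow> A \<subseteq> W - insert x \<sigma>" if "A \<in> F" for A \<sigma>
    using assms(1)[OF that] by blast
  have *: "(\<exists>A\<in>F. A \<subseteq> W - \<sigma> \<and> 2 * s \<le> card A) \<longleftrightarrow>
      (\<exists>A\<in>F. A \<subseteq> W - insert x \<sigma> \<and> 2 * s \<le> card A)" for \<sigma>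
    by (intro bex_cong conj_cong refl sub)
  show "\<sigma> \<in> avoiding F W s \<Longrightarrow> insert x \<sigma> \<in> avoiding F W s"
    using *[of \<sigma>] assms(2) by (simp add: avoiding_def)
  have **: "\<sigma> \<subseteq> W \<and> x \<notin> \<sigma> \<longleftrightarrow> \<sigma> \<subseteq> W - {x}" "W - {x} - \<sigma> = W - insert x \<sigma>" for \<sigma>
    by auto
  have "{\<sigma>\<in>avoiding F W s. x \<notin> \<sigma>} =
      {\<sigma>. (\<sigma> \<subseteq> W \<and> x \<notin> \<sigma>) \<and> (\<exists>A\<in>F. A \<subseteq> W - \<sigma> \<and> 2 * s \<le> card A)}"
    unfolding avoiding_def by blast
  also have "\<dots> = avoiding F (W - {x}) s"
    unfolding avoiding_def **(1) **(2) *[symmetric] ..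
  finally show "{\<sigma>\<in>avoiding F W s. x \<notin> \<sigma>} = avoiding F (W - {x}) s" .
qed

text \<open>
  The deletions are needed for all \<open>x\<close>: the link of \<open>y\<close> in a deletion of \<open>x\<close> is a deletion of \<open>x\<close>
  in a smaller complex, in which \<open>x\<close> may have become a loop.
\<close>

lemma acyclic_at_avoiding_and_deletion:
  fixes F :: "'v::finite set set"
  assumes "even_delta_matroid F"
  shows "(2 * i + 2 * s < card W \<longrightarrow> acyclic_at TYPE('k::comm_ring_1) (avoiding F W s) i) \<and>
    (\<forall>x\<in>W. 2 * i + 2 * s + 1 < card W \<longrightarrow>
      acyclic_at TYPE('k) {\<sigma>\<in>avoiding F W s. x \<notin> \<sigma>} i)"
  using assms
proof (induction "card W" arbitrary: W F s i rule: less_induct)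
  case less
  have IH1: "acyclic_at TYPE('k) (avoiding F W' s) i"
    if "card W' < card W" "2 * i + 2 * s < card W'" "even_delta_matroid F"
    for W' :: "'v set" and F s i
    using less.hyps[OF that(1,3)] that(2) by blast
  have IH2: "acyclic_at TYPE('k) {\<sigma>\<in>avoiding F W' s. x \<notin> \<sigma>} i"
    if "card W' < card W" "x \<in> W'" "2 * i + 2 * s + 1 < card W'" "even_delta_matroid F"
    for W' :: "'v set" and F s i x
    using less.hyps[OF that(1,4)] that(2,3) by blast
  have smaller: "card (W - {x}) = card W - 1" "card (W - {x}) < card W" if "x \<in> W" for x
    using that card_Diff1_less[OF finite that] by auto
  have pair: "\<exists>y\<in>W. y \<noteq> x \<and> {x, y} \<in> F" if "A \<in> F" "A \<subseteq> W" "x \<in> A" for x A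
  proof -
    have "{} \<in> F" using less.prems by (auto simp: even_delta_matroid_def)
    from even_delta_matroidD[OF less.prems this that(1), of x] that
    show ?thesis by auto
  qed
  \<comment> \<open>Contraction lowers \<open>card W\<close> by two and \<open>s\<close> by one,
    which preserves the inequality.\<close>
  have contracted: "acyclic_at TYPE('k) {\<sigma>\<in>avoiding F W (Suc s'). x \<notin> \<sigma> \<and> y \<notin> \<sigma>} i"
    if "{x, y} \<in> F" "x \<in> W" "y \<in> W" "x \<noteq> y" "2 * i + 2 * Suc s' < card W" for x y s' i
  proof -
    have "card (W - {x, y}) = card W - 2"
      using that by (subst card_Diff_subset) auto
    then show ?thesis
      unfolding avoiding_contract[OF less.prems that(1-4)]
      using that by (intro IH1 even_delta_matroid_contract less.prems) auto
  qed
  \<comment> \<open>If \<open>x\<close> lies in a feasible pair, its deletion even satisfies the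
    bound of the whole complex, as is seen by removing \<open>y\<close> too.\<close>
  have Q: "acyclic_at TYPE('k) {\<sigma>\<in>avoiding F W (Suc s'). x \<notin> \<sigma>} i"
    if xy: "{x, y} \<in> F" "x \<in> W" "y \<in> W" "x \<noteq> y" and lt: "2 * i + 2 * Suc s' < card W" for x y s' i
  proof (rule acyclic_at_link_deletion)
    show "\<tau> \<in> {\<sigma> \<in> avoiding F W (Suc s'). x \<notin> \<sigma>}"
      if "insert y \<tau> \<in> {\<sigma> \<in> avoiding F W (Suc s'). x \<notin> \<sigma>}" for \<tau>
      using that by (auto intro: avoiding_subset)
    show "acyclic_at TYPE('k) {\<sigma>\<in>{\<sigma> \<in> avoiding F W (Suc s'). x \<notin> \<sigma>}. y \<notin> \<sigma>} i"
      using contracted[OF xy lt] by (simp add: conj_assoc)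
    fix k assume k: "i = Suc k"
    have "{\<sigma>. y \<notin> \<sigma> \<and> insert y \<sigma> \<in> {\<sigma> \<in> avoiding F W (Suc s'). x \<notin> \<sigma>}} =
        {\<sigma>\<in>avoiding F (W - {y}) (Suc s'). x \<notin> \<sigma>}"
      using xy by (auto simp: avoiding_link[symmetric])
    \<comment> \<open>Lowering the degree by one gains two, which exactly pays for the missing
      vertex \<open>y\<close> and for the extra one in the bound on deletions.\<close>
    moreover have "acyclic_at TYPE('k) {\<sigma>\<in>avoiding F (W - {y}) (Suc s'). x \<notin> \<sigma>} k"
      using xy lt k smaller[OF xy(3)] by (intro IH2 less.prems) auto
    ultimately show "acyclic_at TYPE('k)
        {\<sigma>. y \<notin> \<sigma> \<and> insert y \<sigma> \<in> {\<sigma> \<in> avoiding F W (Suc s'). x \<notin> \<sigma>}} k"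
      by simp
  qed
  show ?case
  proof (intro conjI impI ballI)
    assume lt: "2 * i + 2 * s < card W"
    then obtain x where x: "x \<in> W" by fastforce
    show "acyclic_at TYPE('k) (avoiding F W s) i"
    proof (cases "s = 0 \<or> (\<forall>A\<in>F. A \<subseteq> W \<longrightarrow> x \<notin> A)")
      case True
      then show ?thesis
        using x avoiding_0[OF less.prems] avoiding_loop(2)[of F W x]
        by (intro acyclic_at_cone[of _ x]) auto
    next
      case False
      then obtain y s' where y: "y \<in> W" "x \<noteq> y" "{x, y} \<in> F" "s = Suc s'"
        using pair by (metis not0_implies_Suc)
      show ?thesis
      proof (rule acyclic_at_link_deletion)
        show "\<tau> \<in> avoiding F W s" if "insert x \<tau> \<in> avoiding F W s" for \<tau>
          using that by (auto intro: avoiding_subset)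
        show "acyclic_at TYPE('k) {\<sigma> \<in> avoiding F W s. x \<notin> \<sigma>} i"
          using Q x y lt by auto
        show "acyclic_at TYPE('k) {\<sigma>. x \<notin> \<sigma> \<and> insert x \<sigma> \<in> avoiding F W s} k"
          if "i = Suc k" for k
          unfolding avoiding_link[OF x]
          using smaller[OF x] lt that by (intro IH1 less.prems) auto
      qed
    qed
  next
    fix x assume x: "x \<in> W" and lt: "2 * i + 2 * s + 1 < card W"
    show "acyclic_at TYPE('k) {\<sigma>\<in>avoiding F W s. x \<notin> \<sigma>} i"
    proof (cases "\<forall>A\<in>F. A \<subseteq> W \<longrightarrow> x \<notin> A")
      case True
      then have "{\<sigma>\<in>avoiding F W s. x \<notin> \<sigma>} = avoiding F (W - {x}) s"
        using x by (intro avoiding_loop(1)) auto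
      \<comment> \<open>The extra one in the bound absorbs the loss of \<open>x\<close> from the
        ground set.\<close>
      moreover have "acyclic_at TYPE('k) (avoiding F (W - {x}) s) i"
        using smaller[OF x] lt by (intro IH1 less.prems) auto
      ultimately show ?thesis by simp
    next
      case False
      then obtain y where y: "y \<in> W" "x \<noteq> y" "{x, y} \<in> F" using pair by metis
      show ?thesis
      proof (cases s)
        case 0
        then show ?thesis
          using y avoiding_0[OF less.prems] by (intro acyclic_at_cone[of _ y]) auto
      next
        case (Suc s')
        then show ?thesis using Q[OF y(3) x y(1,2)] lt by auto
      qed
    qed
  qed
qed

lemma acyclic_at_avoiding:
  fixes F :: "'v::finite set set"
  assumes "even_delta_matroid F" "2 * i + 2 * s < card W"
  shows "acyclic_at TYPE('k::comm_ring_1) (avoiding F W s) i"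
  using acyclic_at_avoiding_and_deletion assms by blast

section \<open>Matchable sets\<close>

text \<open>Vertex sets of matchings, built one edge at a time; the matching itself is not
  recorded.\<close>

inductive_set matchable :: "'v set set \<Rightarrow> 'v set set" for E where
  empty: "{} \<in> matchable E"
| edge: "A \<in> matchable E \<Longrightarrow> {x, y} \<in> E \<Longrightarrow> x \<noteq> y \<Longrightarrow> x \<notin> A \<Longrightarrow> y \<notin> A \<Longrightarrow>
    insert x (insert y A) \<in> matchable E"

lemma matchable_remove:
  assumes "A \<in> matchable E" "x \<in> A"
  shows "\<exists>z\<in>A. z \<noteq> x \<and> {x, z} \<in> E \<and> A - {x, z} \<in> matchable E"
  using assms
proof (induction)
  case (edge A u v)
  show ?case
  proof (cases "x \<in> A")
    case True
    then obtain z where z: "z \<in> A" "z \<noteq> x" "{x, z} \<in> E" "A - {x, z} \<in> matchable E"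
      using edge.IH by blast
    have "insert u (insert v A) - {x, z} = insert u (insert v (A - {x, z}))"
      using edge.hyps True z by auto
    moreover have "\<dots> \<in> matchable E"
      using edge.hyps z by - (rule matchable.edge, auto)
    ultimately have "insert u (insert v A) - {x, z} \<in> matchable E" by simp
    then show ?thesis using z(1-3) by blast
  next
    case False
    then consider "x = u" | "x = v" using edge.prems by blast
    then show ?thesis
    proof cases
      case 1
      have "insert u (insert v A) - {x, v} = A" using 1 edge.hyps by auto
      then show ?thesis using 1 edge.hyps by (intro bexI[of _ v]) auto
    next
      case 2
      have "insert u (insert v A) - {x, u} = A" using 2 edge.hyps by auto
      then show ?thesis using 2 edge.hyps by (intro bexI[of _ u]) (auto simp: insert_commute)
    qed
  qed
qed simp

text \<open>
  Following the alternating path from \<open>x\<close> through matchings of \<open>A\<close> and \<open>B\<close>, two edges at a time.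
\<close>

lemma matchable_exchange:
  fixes E :: "'v::finite set set"
  assumes "A \<in> matchable E" "B \<in> matchable E" "x \<in> A - B"
  shows "\<exists>y\<in>sym_diff A B. y \<noteq> x \<and> sym_diff A {x, y} \<in> matchable E \<and> sym_diff B {x, y} \<in> matchable E"
  using assms
proof (induction "card A" arbitrary: A B x rule: less_induct)
  case less
  obtain z where z: "z \<in> A" "z \<noteq> x" "{x, z} \<in> E" "A - {x, z} \<in> matchable E"
    using matchable_remove[OF less.prems(1)] less.prems(3) by blast
  show ?case
  proof (cases "z \<in> B")
    case False
    \<comment> \<open>The path ends at \<open>z\<close>: its single edge moves from \<open>A\<close>
      to \<open>B\<close>.\<close>
    have "sym_diff A {x, z} = A - {x, z}" "sym_diff B {x, z} = insert x (insert z B)"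
      using z less.prems False by auto
    then show ?thesis
      using z False less.prems matchable.edge[OF less.prems(2) z(3)] by (intro bexI[of _ z]) auto
  next
    case True
    then obtain w where w: "w \<in> B" "w \<noteq> z" "{z, w} \<in> E" "B - {z, w} \<in> matchable E"
      using matchable_remove[OF less.prems(2)] by blast
    have wx: "w \<noteq> x" using w less.prems by auto
    show ?thesis
    proof (cases "w \<in> A")
      case False
      have "sym_diff A {x, w} = insert z (insert w (A - {x, z}))"
        "sym_diff B {x, w} = insert x (insert z (B - {z, w}))"
        using z w wx less.prems False True by auto
      moreover have "insert z (insert w (A - {x, z})) \<in> matchable E"
        using z w False by - (rule matchable.edge, auto)
      moreover have "insert x (insert z (B - {z, w})) \<in> matchable E"
        using z w less.prems by - (rule matchable.edge, auto)
      ultimately show ?thesis using w False wx by (intro bexI[of _ w]) auto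
    next
      case wA: True
      \<comment> \<open>The two edges are stripped and the path continues from \<open>w\<close>,
        which is left in \<open>?A\<close> only. Afterwards they are put back with the roles of
        \<open>A\<close> and \<open>B\<close> swapped.\<close>
      let ?A = "A - {x, z}" and ?B = "B - {z, w}"
      have "card ?A < card A" using z by (intro psubset_card_mono) auto
      moreover have "w \<in> ?A - ?B" using wA wx w by auto
      ultimately obtain y where y: "y \<in> sym_diff ?A ?B" "y \<noteq> w"
          "sym_diff ?A {w, y} \<in> matchable E" "sym_diff ?B {w, y} \<in> matchable E"
        using less.hyps[OF _ z(4) w(4)] by blast
      have yxz: "y \<noteq> x" "y \<noteq> z" using y less.prems by auto
      have "sym_diff A {x, y} = insert z (insert w (sym_diff ?A {w, y}))"
        "sym_diff B {x, y} = insert x (insert z (sym_diff ?B {w, y}))"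
        using z w wx less.prems True wA y(1,2) yxz by auto
      moreover have "insert z (insert w (sym_diff ?A {w, y})) \<in> matchable E"
        using z w wA wx y yxz by - (rule matchable.edge, auto)
      moreover have "insert x (insert z (sym_diff ?B {w, y})) \<in> matchable E"
        using z w wx y yxz less.prems by - (rule matchable.edge, auto)
      moreover have "y \<in> sym_diff A B" using y(1,2) yxz by auto
      ultimately show ?thesis using yxz by (intro bexI[of _ y]) auto
    qed
  qed
qed

text \<open>\<open>matchable_exchange\<close> modifies both sets with the same \<open>y\<close>, so
  the case \<open>x \<in> B - A\<close> follows by interchanging them.\<close>

lemma even_delta_matroid_matchable: "even_delta_matroid (matchable (E :: 'v::finite set set))"
  unfolding even_delta_matroid_def
proof (intro conjI ballI matchable.empty)
  fix A B x
  assume *: "A \<in> matchable E" "B \<in> matchable E" "x \<in> sym_diff A B"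
  show "\<exists>y\<in>sym_diff A B. y \<noteq> x \<and> sym_diff A {x, y} \<in> matchable E"
  proof (cases "x \<in> A")
    case True
    then show ?thesis using matchable_exchange[OF *(1,2), of x] * by blast
  next
    case False
    then have "\<exists>y\<in>sym_diff B A. y \<noteq> x \<and> sym_diff B {x, y} \<in> matchable E \<and>
        sym_diff A {x, y} \<in> matchable E"
      using * by (intro matchable_exchange) auto
    then show ?thesis by (auto simp: Un_commute)
  qed
qed

section \<open>The Koszul complex\<close>

definition indicator_exp :: "'v::finite set \<Rightarrow> 'v \<Rightarrow>\<^sub>0 nat" where
  "indicator_exp \<sigma> = (\<Sum>x\<in>\<sigma>. Poly_Mapping.single x 1)"

lemma lookup_indicator_exp:
  "Poly_Mapping.lookup (indicator_exp \<sigma>) x = (if x \<in> \<sigma> then 1 else 0)"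
proof -
  have "Poly_Mapping.lookup (indicator_exp \<sigma>) x = (\<Sum>y\<in>\<sigma>. if x = y then 1 else 0)"
    unfolding indicator_exp_def
    by (simp add: lookup_sum lookup_single when_def eq_commute)
  then show ?thesis by simp
qed

lemma keys_indicator_exp: "Poly_Mapping.keys (indicator_exp \<sigma>) = \<sigma>"
  by (auto simp: in_keys_iff lookup_indicator_exp split: if_splits)

lemma indicator_exp_insert:
  "x \<notin> \<sigma> \<Longrightarrow> indicator_exp (insert x \<sigma>) = Poly_Mapping.single x 1 + indicator_exp \<sigma>"
  by (simp add: indicator_exp_def)

lemma mdegree_eq: "mdegree (m :: 'v::finite \<Rightarrow>\<^sub>0 nat) = (\<Sum>x\<in>UNIV. Poly_Mapping.lookup m x)"
  unfolding mdegree_def by (rule sum.mono_neutral_left) (auto simp: in_keys_iff)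

lemma mdegree_plus: "mdegree (m + m') = mdegree m + mdegree (m' :: 'v::finite \<Rightarrow>\<^sub>0 nat)"
  by (simp add: mdegree_eq lookup_add sum.distrib)

lemma mdegree_indicator_exp: "mdegree (indicator_exp \<sigma>) = card \<sigma>"
  by (simp add: mdegree_def keys_indicator_exp lookup_indicator_exp)

lemma minus_plus_indicator_exp:
  assumes "\<sigma> \<subseteq> Poly_Mapping.keys a"
  shows "a - indicator_exp \<sigma> + indicator_exp \<sigma> = a"
proof (rule poly_mapping_eqI)
  fix x
  have "x \<in> \<sigma> \<Longrightarrow> Poly_Mapping.lookup a x \<ge> 1"
    using assms by (auto simp: in_keys_iff Suc_le_eq)
  then show "Poly_Mapping.lookup (a - indicator_exp \<sigma> + indicator_exp \<sigma>) x = Poly_Mapping.lookup a x"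
    by (auto simp: lookup_add lookup_minus lookup_indicator_exp)
qed

lemma subset_keys_plus_indicator_exp: "\<sigma> \<subseteq> Poly_Mapping.keys (m + indicator_exp \<sigma>)"
  by (auto simp: in_keys_iff lookup_add lookup_indicator_exp)

lemma lookup_var_times:
  fixes p :: "('v::finite, 'k::comm_ring_1) mpoly"
  shows "Poly_Mapping.lookup (var x * p) m =
    (if x \<in> Poly_Mapping.keys m then Poly_Mapping.lookup p (m - Poly_Mapping.single x 1) else 0)"
proof -
  let ?x = "Poly_Mapping.single x (1::nat)"
  have "Poly_Mapping.lookup (var x * p) m =
      (\<Sum>l. (\<Sum>q. Poly_Mapping.lookup p q when m = l + q) when ?x = l)"
    by (simp add: var_def lookup_mult lookup_single when_mult)
  also have "\<dots> = (\<Sum>q. Poly_Mapping.lookup p q when m = ?x + q)"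
    by simp
  also have "\<dots> = (if x \<in> Poly_Mapping.keys m then Poly_Mapping.lookup p (m - ?x) else 0)"
  proof (cases "x \<in> Poly_Mapping.keys m")
    case True
    have "m = ?x + (m - ?x)"
      using minus_plus_indicator_exp[of "{x}" m] True by (simp add: indicator_exp_def add.commute)
    then have "m = ?x + q \<longleftrightarrow> q = m - ?x" for q by auto
    then show ?thesis using True by simp
  next
    case False
    then have "m \<noteq> ?x + q" for q by (auto simp: in_keys_iff lookup_add)
    then show ?thesis using False by simp
  qed
  finally show ?thesis .
qed

text \<open>A chain lists the coefficients of the exterior basis elements indexed by
  \<open>\<sigma>\<close>; the signs are those of \<open>boundary\<close>.\<close>

definition koszul :: "('v::finite set \<Rightarrow> ('v, 'k::comm_ring_1) mpoly) \<Rightarrow> 'v set \<Rightarrow> ('v, 'k) mpoly" where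
  "koszul c \<sigma> = (\<Sum>x\<in>-\<sigma>. sg x \<sigma> * (var x * c (insert x \<sigma>)))"

lemma koszul_add: "koszul (\<lambda>\<sigma>. c \<sigma> + d \<sigma>) \<sigma> = koszul c \<sigma> + koszul d \<sigma>"
  by (simp add: koszul_def sum.distrib distrib_left)

lemma koszul_sum:
  "koszul (\<lambda>\<sigma>. \<Sum>b\<in>B. f b * w b \<sigma>) \<sigma> = (\<Sum>b\<in>B. f b * koszul (w b) \<sigma>)"
  unfolding koszul_def sum_distrib_left
  by (subst sum.swap) (simp add: mult_ac)

lemma lookup_sg_times:
  "Poly_Mapping.lookup (sg x \<sigma> * p) m = sg x \<sigma> * Poly_Mapping.lookup (p :: ('v::finite, 'k::comm_ring_1) mpoly) m"
  by (simp add: sg_def)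

text \<open>
  The component of multidegree \<open>a\<close>: the coefficient \<open>strand a c \<sigma>\<close> belongs to the monomial
  \<open>x\<^bsup>a - \<sigma>\<^esup>\<close>.
\<close>

definition strand :: "('v::finite \<Rightarrow>\<^sub>0 nat) \<Rightarrow> ('v set \<Rightarrow> ('v, 'k::comm_ring_1) mpoly) \<Rightarrow> 'v set \<Rightarrow> 'k" where
  "strand a c \<sigma> = (if \<sigma> \<subseteq> Poly_Mapping.keys a
     then Poly_Mapping.lookup (c \<sigma>) (a - indicator_exp \<sigma>) else 0)"

lemma strand_plus: "strand (m + indicator_exp \<sigma>) c \<sigma> = Poly_Mapping.lookup (c \<sigma>) m"
  by (simp add: strand_def subset_keys_plus_indicator_exp)

text \<open>Multiplication by \<open>var x\<close> turns the exponent
  \<open>a - indicator_exp (insert x \<sigma>)\<close> into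
  \<open>a - indicator_exp \<sigma>\<close>, so within one multidegree only the signs
  remain.\<close>

lemma strand_koszul: "strand a (koszul c) = boundary (strand a c)"
proof
  fix \<sigma>
  show "strand a (koszul c) \<sigma> = boundary (strand a c) \<sigma>"
  proof (cases "\<sigma> \<subseteq> Poly_Mapping.keys a")
    case False
    then show ?thesis by (auto simp: strand_def boundary_def intro!: sum.neutral[symmetric])
  next
    case True
    have "strand a (koszul c) \<sigma> = (\<Sum>x\<in>-\<sigma>. sg x \<sigma> *
        Poly_Mapping.lookup (var x * c (insert x \<sigma>)) (a - indicator_exp \<sigma>))"
      using True by (simp add: strand_def koszul_def lookup_sum lookup_sg_times)
    also have "\<dots> = boundary (strand a c) \<sigma>"
      unfolding boundary_def
    proof (rule sum.cong)
      fix x assume x: "x \<in> -\<sigma>"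
      have "x \<in> Poly_Mapping.keys (a - indicator_exp \<sigma>) \<longleftrightarrow> x \<in> Poly_Mapping.keys a"
        using x by (simp add: in_keys_iff lookup_minus lookup_indicator_exp)
      moreover have "a - indicator_exp \<sigma> - Poly_Mapping.single x 1 = a - indicator_exp (insert x \<sigma>)"
        using x by (simp add: indicator_exp_insert diff_diff_add add.commute)
      ultimately show "sg x \<sigma> * Poly_Mapping.lookup (var x * c (insert x \<sigma>)) (a - indicator_exp \<sigma>) =
          sg x \<sigma> * strand a c (insert x \<sigma>)"
        using True by (simp add: lookup_var_times strand_def)
    qed simp
    finally show ?thesis .
  qed
qed

lemma koszul_eq_if_strands:
  assumes "\<And>a. strand a c = strand a d"
  shows "c = d"
proof
  fix \<sigma>
  show "c \<sigma> = d \<sigma>"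
    by (rule poly_mapping_eqI) (metis assms strand_plus)
qed

lemma koszul_koszul: "koszul (koszul c) \<sigma> = 0"
proof -
  have "koszul (koszul c) = (\<lambda>_. 0)"
    by (rule koszul_eq_if_strands)
      (simp add: strand_koszul boundary_boundary fun_eq_iff strand_def[of _ "\<lambda>_. 0"])
  then show ?thesis by simp
qed

text \<open>Only finitely many multidegrees occur in \<open>c\<close>, so solutions found strand by
  strand add up to polynomials. \<open>P\<close> stands for membership in a monomial ideal; the last
  conclusion confines \<open>U\<close> to multidegrees of \<open>c\<close>.\<close>

lemma koszul_exact_if_strands_exact:
  fixes c :: "'v::finite set \<Rightarrow> ('v, 'k::comm_ring_1) mpoly"
  assumes ex: "\<And>a. (\<exists>\<sigma>. strand a c \<sigma> \<noteq> 0) \<Longrightarrow> \<exists>u. boundary u = strand a c \<and>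
      (\<forall>\<sigma>. u \<sigma> \<noteq> 0 \<longrightarrow> \<sigma> \<subseteq> Poly_Mapping.keys a \<and> card \<sigma> = i \<and> P (a - indicator_exp \<sigma>))"
  obtains U where "koszul U = c"
    "\<And>\<sigma> m. m \<in> Poly_Mapping.keys (U \<sigma>) \<Longrightarrow>
      card \<sigma> = i \<and> P m \<and> (\<exists>\<tau>. strand (m + indicator_exp \<sigma>) c \<tau> \<noteq> 0)"
proof -
  define S where "S = {a. \<exists>\<sigma>. strand a c \<sigma> \<noteq> 0}"
  have "S \<subseteq> (\<Union>\<sigma>. (\<lambda>m. m + indicator_exp \<sigma>) ` Poly_Mapping.keys (c \<sigma>))"
  proof
    fix a assume "a \<in> S"
    then obtain \<sigma> where \<sigma>: "strand a c \<sigma> \<noteq> 0" by (auto simp: S_def)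
    then have "\<sigma> \<subseteq> Poly_Mapping.keys a" "a - indicator_exp \<sigma> \<in> Poly_Mapping.keys (c \<sigma>)"
      by (auto simp: strand_def in_keys_iff split: if_splits)
    then show "a \<in> (\<Union>\<sigma>. (\<lambda>m. m + indicator_exp \<sigma>) ` Poly_Mapping.keys (c \<sigma>))"
      using minus_plus_indicator_exp[of \<sigma> a]
      by (intro UN_I[of \<sigma>] image_eqI[of _ _ "a - indicator_exp \<sigma>"]) auto
  qed
  then have fin: "finite S" by (rule finite_subset) auto
  have "\<forall>a\<in>S. \<exists>u. boundary u = strand a c \<and>
      (\<forall>\<sigma>. u \<sigma> \<noteq> 0 \<longrightarrow> \<sigma> \<subseteq> Poly_Mapping.keys a \<and> card \<sigma> = i \<and> P (a - indicator_exp \<sigma>))"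
    using ex by (simp add: S_def)
  from bchoice[OF this] obtain u where u': "\<forall>a\<in>S. boundary (u a) = strand a c \<and>
      (\<forall>\<sigma>. u a \<sigma> \<noteq> 0 \<longrightarrow> \<sigma> \<subseteq> Poly_Mapping.keys a \<and> card \<sigma> = i \<and> P (a - indicator_exp \<sigma>))"
    by (rule exE)
  have u: "boundary (u a) = strand a c"
      "u a \<sigma> \<noteq> 0 \<Longrightarrow> \<sigma> \<subseteq> Poly_Mapping.keys a \<and> card \<sigma> = i \<and> P (a - indicator_exp \<sigma>)"
    if "a \<in> S" for a \<sigma>
    using u' that by blast+
  define U where "U = (\<lambda>\<sigma>. \<Sum>a\<in>S. if \<sigma> \<subseteq> Poly_Mapping.keys a
    then Poly_Mapping.single (a - indicator_exp \<sigma>) (u a \<sigma>) else 0)"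
  have lookup_U: "Poly_Mapping.lookup (U \<sigma>) m =
      (if m + indicator_exp \<sigma> \<in> S then u (m + indicator_exp \<sigma>) \<sigma> else 0)" for \<sigma> m
  proof -
    have "Poly_Mapping.lookup (U \<sigma>) m =
        (\<Sum>a\<in>S. if m + indicator_exp \<sigma> = a then u a \<sigma> else 0)"
      unfolding U_def lookup_sum
    proof (rule sum.cong)
      fix a
      show "Poly_Mapping.lookup (if \<sigma> \<subseteq> Poly_Mapping.keys a
          then Poly_Mapping.single (a - indicator_exp \<sigma>) (u a \<sigma>) else 0) m =
          (if m + indicator_exp \<sigma> = a then u a \<sigma> else 0)"
        using subset_keys_plus_indicator_exp[of \<sigma> m] minus_plus_indicator_exp[of \<sigma> a]
        by (auto simp: lookup_single when_def)
    qed simp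
    then show ?thesis using fin by simp
  qed
  have strand_U: "strand a U = (if a \<in> S then u a else (\<lambda>_. 0))" for a
  proof
    fix \<sigma>
    show "strand a U \<sigma> = (if a \<in> S then u a else (\<lambda>_. 0)) \<sigma>"
      using u(2)[of a \<sigma>] minus_plus_indicator_exp[of \<sigma> a]
      by (auto simp: strand_def lookup_U)
  qed
  have "strand a (koszul U) = strand a c" for a
  proof (cases "a \<in> S")
    case True
    then show ?thesis by (simp add: strand_koszul strand_U u)
  next
    case False
    then have "strand a c = (\<lambda>_. 0)" by (auto simp: S_def)
    then show ?thesis using False by (simp add: strand_koszul strand_U boundary_def fun_eq_iff)
  qed
  then have "koszul U = c" by (rule koszul_eq_if_strands)
  moreover have "card \<sigma> = i \<and> P m \<and> (\<exists>\<tau>. strand (m + indicator_exp \<sigma>) c \<tau> \<noteq> 0)"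
    if "m \<in> Poly_Mapping.keys (U \<sigma>)" for \<sigma> m
  proof -
    have "m + indicator_exp \<sigma> \<in> S" "u (m + indicator_exp \<sigma>) \<sigma> \<noteq> 0"
      using that by (auto simp: in_keys_iff lookup_U split: if_splits)
    then show ?thesis using u(2)[of "m + indicator_exp \<sigma>" \<sigma>] by (auto simp: S_def)
  qed
  ultimately show thesis by (rule that)
qed

text \<open>The basis element at \<open>\<sigma>\<close> has degree \<open>card \<sigma>\<close>.
  The total degree \<open>d\<close> is an integer because differences of shifts, possibly negative,
  will be inserted.\<close>

definition koszul_chain :: "nat \<Rightarrow> int \<Rightarrow> ('v::finite set \<Rightarrow> ('v, 'k::comm_ring_1) mpoly) \<Rightarrow> bool" where
  "koszul_chain i d c \<longleftrightarrow>
     (\<forall>\<sigma>. \<forall>m\<in>Poly_Mapping.keys (c \<sigma>). card \<sigma> = i \<and> int (mdegree m) + int i = d)"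

lemma strand_koszul_chain:
  assumes "koszul_chain i d c" "strand a c \<sigma> \<noteq> 0"
  shows "\<sigma> \<subseteq> Poly_Mapping.keys a" "card \<sigma> = i" "int (mdegree a) = d"
proof -
  show \<sigma>: "\<sigma> \<subseteq> Poly_Mapping.keys a"
    using assms(2) by (auto simp: strand_def split: if_splits)
  then have *: "a - indicator_exp \<sigma> \<in> Poly_Mapping.keys (c \<sigma>)"
    using assms(2) by (auto simp: strand_def in_keys_iff)
  then show "card \<sigma> = i" using assms(1) by (auto simp: koszul_chain_def)
  have "mdegree a = mdegree (a - indicator_exp \<sigma>) + card \<sigma>"
    using minus_plus_indicator_exp[OF \<sigma>] by (metis mdegree_plus mdegree_indicator_exp)
  then show "int (mdegree a) = d"
    using * assms(1) \<open>card \<sigma> = i\<close> by (auto simp: koszul_chain_def)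
qed

text \<open>If \<open>P\<close> describes a monomial ideal, its Koszul complex in multidegree
  \<open>a\<close> is the complex of the sets that can be subtracted from \<open>a\<close> without
  leaving the ideal.\<close>

lemma koszul_exact:
  fixes c :: "'v::finite set \<Rightarrow> ('v, 'k::comm_ring_1) mpoly"
  assumes c: "koszul_chain i d c" and cyc: "\<And>\<sigma>. koszul c \<sigma> = 0"
    and acyc: "\<And>a. int (mdegree a) = d \<Longrightarrow> (\<exists>\<sigma>. strand a c \<sigma> \<noteq> 0) \<Longrightarrow>
      acyclic_at TYPE('k) {\<sigma>. \<sigma> \<subseteq> Poly_Mapping.keys a \<and> P (a - indicator_exp \<sigma>)} i"
    and P: "\<And>\<sigma> m. m \<in> Poly_Mapping.keys (c \<sigma>) \<Longrightarrow> P m"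
  obtains U where "koszul U = c" "koszul_chain (Suc i) d U"
    "\<And>\<sigma> m. m \<in> Poly_Mapping.keys (U \<sigma>) \<Longrightarrow> P m"
proof (rule koszul_exact_if_strands_exact[of c "Suc i" P])
  fix a
  assume nz: "\<exists>\<sigma>. strand a c \<sigma> \<noteq> 0"
  let ?\<Delta> = "{\<sigma>. \<sigma> \<subseteq> Poly_Mapping.keys a \<and> P (a - indicator_exp \<sigma>)}"
  have "chain_on ?\<Delta> i (strand a c)"
    unfolding chain_on_def
  proof (intro allI impI)
    fix \<sigma> assume *: "strand a c \<sigma> \<noteq> 0"
    then have "a - indicator_exp \<sigma> \<in> Poly_Mapping.keys (c \<sigma>)"
      by (auto simp: strand_def in_keys_iff split: if_splits)
    then show "\<sigma> \<in> ?\<Delta> \<and> card \<sigma> = i"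
      using P strand_koszul_chain[OF c *] by auto
  qed
  moreover have "boundary (strand a c) \<sigma> = 0" for \<sigma>
    unfolding strand_koszul[symmetric] by (simp add: strand_def cyc)
  moreover have "int (mdegree a) = d" using nz strand_koszul_chain[OF c] by blast
  ultimately obtain u where "chain_on ?\<Delta> (Suc i) u" "boundary u = strand a c"
    using acyc nz unfolding acyclic_at_def by blast
  then show "\<exists>u. boundary u = strand a c \<and> (\<forall>\<sigma>. u \<sigma> \<noteq> 0 \<longrightarrow>
      \<sigma> \<subseteq> Poly_Mapping.keys a \<and> card \<sigma> = Suc i \<and> P (a - indicator_exp \<sigma>))"
    by (auto simp: chain_on_def)
next
  fix U
  assume U: "koszul U = c" "\<And>\<sigma> m. m \<in> Poly_Mapping.keys (U \<sigma>) \<Longrightarrow>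
      card \<sigma> = Suc i \<and> P m \<and> (\<exists>\<tau>. strand (m + indicator_exp \<sigma>) c \<tau> \<noteq> 0)"
  have "koszul_chain (Suc i) d U"
    unfolding koszul_chain_def
  proof (intro allI ballI)
    fix \<sigma> m assume "m \<in> Poly_Mapping.keys (U \<sigma>)"
    with U(2) obtain \<tau> where "card \<sigma> = Suc i" "strand (m + indicator_exp \<sigma>) c \<tau> \<noteq> 0" by blast
    then show "card \<sigma> = Suc i \<and> int (mdegree m) + int (Suc i) = d"
      using strand_koszul_chain(3)[OF c, of "m + indicator_exp \<sigma>" \<tau>]
      by (simp add: mdegree_plus mdegree_indicator_exp)
  qed
  then show thesis using U by (intro that[of U]) blast+
qed

text \<open>In a multidegree \<open>a \<noteq> 0\<close> the complex is a full simplex on a nonempty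
  set, hence a cone. The constants, in multidegree 0, are excluded by \<open>const\<close>.\<close>

lemma koszul_exact_polynomials:
  fixes c :: "'v::finite set \<Rightarrow> ('v, 'k::comm_ring_1) mpoly"
  assumes c: "koszul_chain i d c" and cyc: "\<And>\<sigma>. koszul c \<sigma> = 0"
    and const: "Poly_Mapping.lookup (c {}) 0 = 0"
  obtains U where "koszul U = c" "koszul_chain (Suc i) d U"
proof (rule koszul_exact[OF c cyc, of "\<lambda>_. True"])
  fix a
  assume nz: "\<exists>\<sigma>. strand a c \<sigma> \<noteq> 0"
  have "a \<noteq> 0"
  proof
    assume "a = 0"
    then have "strand a c \<sigma> = 0" for \<sigma>
      using const by (auto simp: strand_def indicator_exp_def)
    with nz show False by simp
  qed
  then obtain x where "x \<in> Poly_Mapping.keys a" by fastforce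
  then show "acyclic_at TYPE('k) {\<sigma>. \<sigma> \<subseteq> Poly_Mapping.keys a \<and> True} i"
    by (intro acyclic_at_cone[of _ x]) auto
qed (use that in auto)

section \<open>Monomial ideals\<close>

lemma module_times: "Modules.module ((*) :: 'r::comm_ring_1 \<Rightarrow> 'r \<Rightarrow> 'r)"
  by unfold_locales (simp_all add: algebra_simps)

lemma ideal_gen_base: "p \<in> B \<Longrightarrow> p \<in> ideal_gen B"
  unfolding ideal_gen_def by (rule module.span_base[OF module_times])

lemma ideal_gen_times: "p \<in> ideal_gen B \<Longrightarrow> q * p \<in> ideal_gen B"
  unfolding ideal_gen_def by (rule module.span_scale[OF module_times])

lemma ideal_gen_sum: "(\<And>a. a \<in> A \<Longrightarrow> f a \<in> ideal_gen B) \<Longrightarrow> sum f A \<in> ideal_gen B"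
  unfolding ideal_gen_def by (rule module.span_sum[OF module_times])

text \<open>The polynomials whose exponents all satisfy an upward closed property form an ideal, and
  it contains \<open>B\<close>.\<close>

lemma keys_ideal_gen:
  fixes B :: "('v, 'k::comm_ring_1) mpoly set"
  assumes up: "\<And>m m'. P m \<Longrightarrow> P (m' + m)"
    and B: "\<And>p m. p \<in> B \<Longrightarrow> m \<in> Poly_Mapping.keys p \<Longrightarrow> P m"
    and p: "p \<in> ideal_gen B" and m: "m \<in> Poly_Mapping.keys p"
  shows "P m"
proof -
  let ?S = "{p :: ('v, 'k) mpoly. \<forall>m\<in>Poly_Mapping.keys p. P m}"
  have "module.subspace (*) ?S"
  proof (rule module.subspaceI[OF module_times])
    show "x + y \<in> ?S" if "x \<in> ?S" "y \<in> ?S" for x y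
      using that Poly_Mapping.keys_add[of x y] by auto
    show "c * x \<in> ?S" if "x \<in> ?S" for c x
      using that up keys_mult[of c x] by fastforce
  qed simp
  then have "ideal_gen B \<subseteq> ?S"
    unfolding ideal_gen_def using B by (intro module.span_minimal[OF module_times]) auto
  then show ?thesis using p m by auto
qed

text \<open>Starting from an arbitrary \<open>m\<close> makes these the exponents divisible by a
  product of \<open>s\<close> edges, repetitions allowed.\<close>

inductive edge_product :: "'v set set \<Rightarrow> nat \<Rightarrow> ('v \<Rightarrow>\<^sub>0 nat) \<Rightarrow> bool" for E where
  zero: "edge_product E 0 m"
| Suc: "edge_product E s m \<Longrightarrow> {x, y} \<in> E \<Longrightarrow>
    edge_product E (Suc s) (Poly_Mapping.single x 1 + (Poly_Mapping.single y 1 + m))"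

lemma edge_product_plus: "edge_product E s m \<Longrightarrow> edge_product E s (m' + m)"
proof (induction rule: edge_product.induct)
  case (Suc s m x y)
  then show ?case
    using edge_product.Suc[OF Suc.IH Suc.hyps(2)] by (simp add: ac_simps)
qed (rule edge_product.zero)

lemma keys_var: "Poly_Mapping.keys (var x :: ('v, 'k::comm_ring_1) mpoly) = {Poly_Mapping.single x 1}"
  by (simp add: var_def)

lemma keys_edge_ideal:
  fixes p :: "('v, 'k::comm_ring_1) mpoly"
  assumes "p \<in> edge_ideal E" "m \<in> Poly_Mapping.keys p"
  shows "edge_product E 1 m"
proof (rule keys_ideal_gen[where P = "edge_product E 1", OF edge_product_plus _ assms[unfolded edge_ideal_def]])
  fix q :: "('v, 'k) mpoly" and m
  assume "q \<in> {var x * var y | x y. {x, y} \<in> E}" "m \<in> Poly_Mapping.keys q"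
  then obtain x y where xy: "{x, y} \<in> E" "m \<in> Poly_Mapping.keys (var x * var y :: ('v, 'k) mpoly)"
    by auto
  then have "m = Poly_Mapping.single x 1 + (Poly_Mapping.single y 1 + 0)"
    using keys_mult[of "var x" "var y :: ('v, 'k) mpoly"] by (auto simp: keys_var)
  then show "edge_product E 1 m"
    using edge_product.Suc[OF edge_product.zero[of E 0] xy(1)] by simp
qed

lemma keys_prod_edge_ideal:
  fixes f :: "nat \<Rightarrow> ('v, 'k::comm_ring_1) mpoly"
  assumes "\<forall>i<s. f i \<in> edge_ideal E" "m \<in> Poly_Mapping.keys (\<Prod>i<s. f i)"
  shows "edge_product E s m"
  using assms
proof (induction s arbitrary: m)
  case 0
  then show ?case by (simp add: edge_product.zero)
next
  case (Suc s)
  then obtain a b where ab: "m = a + b" "a \<in> Poly_Mapping.keys (\<Prod>i<s. f i)" "b \<in> Poly_Mapping.keys (f s)"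
    using keys_mult[of "\<Prod>i<s. f i" "f s"] by auto
  have "edge_product E s a" using Suc ab(2) by simp
  moreover have "edge_product E 1 b" using keys_edge_ideal ab(3) Suc.prems by blast
  then obtain x y b' where "{x, y} \<in> E" "b = Poly_Mapping.single x 1 + (Poly_Mapping.single y 1 + b')"
    by (auto elim: edge_product.cases)
  ultimately have "edge_product E (Suc s) (Poly_Mapping.single x 1 + (Poly_Mapping.single y 1 + (b' + a)))"
    by (intro edge_product.Suc edge_product_plus)
  then show ?case using ab(1) \<open>b = _\<close> by (simp add: ac_simps)
qed

text \<open>In a squarefree monomial the edge factors cannot share a vertex, so they form a
  matching.\<close>

lemma edge_product_squarefree:
  assumes "edge_product E s m" "\<And>x. Poly_Mapping.lookup m x \<le> 1"
  shows "\<exists>A\<in>matchable E. A \<subseteq> Poly_Mapping.keys (m :: 'v::finite \<Rightarrow>\<^sub>0 nat) \<and> card A = 2 * s"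
  using assms
proof induction
  case (zero m)
  then show ?case by (intro bexI[of _ "{}"]) (auto intro: matchable.empty)
next
  case (Suc s m x y)
  let ?m = "Poly_Mapping.single x 1 + (Poly_Mapping.single y 1 + m)"
  have lookup: "Poly_Mapping.lookup ?m z =
      (if x = z then 1 else 0) + ((if y = z then 1 else 0) + Poly_Mapping.lookup m z)" for z
    by (simp add: lookup_add lookup_single when_def)
  have "Poly_Mapping.lookup m z \<le> 1" for z
    using Suc.prems[of z] unfolding lookup by linarith
  then obtain A where A: "A \<in> matchable E" "A \<subseteq> Poly_Mapping.keys m" "card A = 2 * s"
    using Suc.IH by blast
  have xy: "x \<noteq> y" "Poly_Mapping.lookup m x = 0" "Poly_Mapping.lookup m y = 0"
    using Suc.prems[of x] Suc.prems[of y] unfolding lookup by (auto split: if_splits)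
  then have notin: "x \<notin> A" "y \<notin> A" using A(2) by (auto simp: in_keys_iff)
  have "insert x (insert y A) \<in> matchable E"
    using A(1) Suc.hyps(2) xy(1) notin by (rule matchable.edge)
  moreover have "insert x (insert y A) \<subseteq> Poly_Mapping.keys ?m"
    unfolding subset_iff in_keys_iff lookup using A(2) by (auto simp: in_keys_iff)
  moreover have "card (insert x (insert y A)) = 2 * Suc s"
    using xy(1) notin A(3) by simp
  ultimately show ?case by blast
qed

lemma prod_var: "(\<Prod>x\<in>A. var x) = Poly_Mapping.single (indicator_exp A) (1 :: 'k::comm_ring_1)"
  if "finite A" for A :: "'v::finite set"
  using that by induction (simp_all add: indicator_exp_def var_def mult_single)

text \<open>By \<open>keys_squarefree_power\<close> and \<open>squarefree_powerI\<close>, a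
  polynomial lies in the squarefree power exactly when all its exponents satisfy this.\<close>

definition contains_matchable :: "'v set set \<Rightarrow> nat \<Rightarrow> ('v \<Rightarrow>\<^sub>0 nat) \<Rightarrow> bool" where
  "contains_matchable E s m \<longleftrightarrow> (\<exists>A\<in>matchable E. A \<subseteq> Poly_Mapping.keys m \<and> 2 * s \<le> card A)"

lemma contains_matchable_plus:
  "contains_matchable E s m \<Longrightarrow> contains_matchable E s (m' + m)"
proof -
  have "Poly_Mapping.keys m \<subseteq> Poly_Mapping.keys (m' + m)"
    by (auto simp: in_keys_iff lookup_add)
  then show "contains_matchable E s m \<Longrightarrow> contains_matchable E s (m' + m)"
    unfolding contains_matchable_def by (meson subset_trans)
qed

lemma keys_squarefree_power:
  fixes p :: "('v::finite, 'k::comm_ring_1) mpoly"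
  assumes "p \<in> squarefree_power (edge_ideal E) s" "m \<in> Poly_Mapping.keys p"
  shows "contains_matchable E s m"
proof (rule keys_ideal_gen[where P = "contains_matchable E s",
      OF contains_matchable_plus _ assms[unfolded squarefree_power_def]])
  fix q :: "('v, 'k) mpoly" and m
  assume q: "q \<in> {p \<in> ideal_power (edge_ideal E) s. squarefree_monomial p}"
    and m: "m \<in> Poly_Mapping.keys q"
  have "edge_product E s m"
  proof (rule keys_ideal_gen[where P = "edge_product E s", OF edge_product_plus])
    show "q \<in> ideal_gen {\<Prod>i<s. f i | f. \<forall>i<s. f i \<in> edge_ideal E}"
      using q by (simp add: ideal_power_def)
    show "edge_product E s m'" if "p \<in> {\<Prod>i<s. f i | f. \<forall>i<s. f i \<in> edge_ideal E}"
      "m' \<in> Poly_Mapping.keys p" for p :: "('v, 'k) mpoly" and m'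
      using that keys_prod_edge_ideal by blast
  qed (assumption | rule m)+
  moreover obtain U where "q = (\<Prod>x\<in>U. var x)" using q by (auto simp: squarefree_monomial_def)
  then have "m = indicator_exp U" using m by (simp add: prod_var)
  ultimately have "\<exists>A\<in>matchable E. A \<subseteq> Poly_Mapping.keys m \<and> card A = 2 * s"
    by (intro edge_product_squarefree) (simp_all add: lookup_indicator_exp)
  then show "contains_matchable E s m" by (auto simp: contains_matchable_def)
qed

section \<open>Matchings as generators of the squarefree power\<close>

lemma matchable_card_even: "A \<in> matchable E \<Longrightarrow> even (card (A :: 'v::finite set))"
  by (induction rule: matchable.induct) auto

lemma matchable_subset:
  fixes A :: "'v::finite set"
  assumes "A \<in> matchable E" "2 * s \<le> card A"
  shows "\<exists>B\<in>matchable E. B \<subseteq> A \<and> card B = 2 * s"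
  using assms
proof induction
  case empty
  then show ?case by (auto intro: matchable.empty)
next
  case (edge A x y)
  show ?case
  proof (cases "2 * s \<le> card A")
    case True
    then show ?thesis using edge.IH by blast
  next
    case False
    moreover have "card (insert x (insert y A)) = card A + 2" using edge.hyps by simp
    ultimately have "card (insert x (insert y A)) = 2 * s"
      using edge.prems matchable_card_even[OF edge.hyps(1)] by presburger
    then show ?thesis using matchable.edge[OF edge.hyps] by blast
  qed
qed

lemma matchable_prod_edges:
  fixes A :: "'v::finite set"
  assumes "A \<in> matchable E" "card A = 2 * s"
  shows "\<exists>f. (\<forall>i<s. f i \<in> edge_ideal E) \<and>
    (\<Prod>i<s. f i) = (\<Prod>x\<in>A. var x :: ('v, 'k::comm_ring_1) mpoly)"
  using assms
proof (induction arbitrary: s)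
  case empty
  then show ?case by simp
next
  case (edge A x y)
  then obtain t where t: "s = Suc t" "card A = 2 * t" by (cases s) auto
  with edge.IH obtain f where f: "\<forall>i<t. f i \<in> edge_ideal E"
      "(\<Prod>i<t. f i) = (\<Prod>x\<in>A. var x :: ('v, 'k) mpoly)" by blast
  have xy: "var x * var y \<in> (edge_ideal E :: ('v, 'k) mpoly set)"
    unfolding edge_ideal_def using edge.hyps(2) by (intro ideal_gen_base) blast
  show ?case
  proof (intro exI conjI)
    show "\<forall>i<s. (f(t := var x * var y)) i \<in> edge_ideal E" using f(1) xy t by auto
    have "(\<Prod>i<s. (f(t := var x * var y)) i) = (\<Prod>i<t. f i) * (var x * var y)"
      by (simp add: t)
    then show "(\<Prod>i<s. (f(t := var x * var y)) i) = (\<Prod>x\<in>insert x (insert y A). var x)"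
      using edge.hyps by (simp add: f(2) mult_ac)
  qed
qed

lemma sum_monomials:
  "(\<Sum>m\<in>Poly_Mapping.keys p. Poly_Mapping.single m (Poly_Mapping.lookup p m)) = p"
  by (rule poly_mapping_eqI) (auto simp: lookup_sum lookup_single when_def in_keys_iff)

text \<open>Each term of \<open>p\<close> is a multiple of the squarefree monomial of a matching
  with exactly \<open>s\<close> edges, which is a generator.\<close>

lemma squarefree_powerI:
  fixes p :: "('v::finite, 'k::comm_ring_1) mpoly"
  assumes "\<And>m. m \<in> Poly_Mapping.keys p \<Longrightarrow> contains_matchable E s m"
  shows "p \<in> squarefree_power (edge_ideal E) s"
proof -
  have "Poly_Mapping.single m (Poly_Mapping.lookup p m) \<in> squarefree_power (edge_ideal E) s"
    if m: "m \<in> Poly_Mapping.keys p" for m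
  proof -
    obtain A where A: "A \<in> matchable E" "A \<subseteq> Poly_Mapping.keys m" "card A = 2 * s"
      using assms[OF m] matchable_subset unfolding contains_matchable_def by blast
    obtain f where "\<forall>i<s. f i \<in> edge_ideal E" "(\<Prod>i<s. f i) = (\<Prod>x\<in>A. var x :: ('v, 'k) mpoly)"
      using matchable_prod_edges[OF A(1,3)] by blast
    then have "(\<Prod>x\<in>A. var x :: ('v, 'k) mpoly) \<in> ideal_power (edge_ideal E) s"
      unfolding ideal_power_def by (intro ideal_gen_base CollectI exI[of _ f]) simp
    then have *: "(\<Prod>x\<in>A. var x :: ('v, 'k) mpoly) \<in> squarefree_power (edge_ideal E) s"
      unfolding squarefree_power_def squarefree_monomial_def by (intro ideal_gen_base) blast
    have "Poly_Mapping.single m (Poly_Mapping.lookup p m) =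
        Poly_Mapping.single (m - indicator_exp A) (Poly_Mapping.lookup p m) * (\<Prod>x\<in>A. var x)"
      using minus_plus_indicator_exp[OF A(2)] by (simp add: prod_var mult_single)
    then show ?thesis
      using * unfolding squarefree_power_def by (simp add: ideal_gen_times)
  qed
  then have "(\<Sum>m\<in>Poly_Mapping.keys p. Poly_Mapping.single m (Poly_Mapping.lookup p m))
      \<in> squarefree_power (edge_ideal E) s"
    unfolding squarefree_power_def by (intro ideal_gen_sum)
  then show ?thesis by (simp only: sum_monomials)
qed

text \<open>A variable of exponent at least 2 stays in the support after subtraction, so it is an
  apex. Otherwise \<open>a\<close> is squarefree and the complex is an \<open>avoiding\<close>
  complex; its degree is at most the number of variables, which leaves the first
  alternative.\<close>

lemma acyclic_at_strand:
  fixes a :: "'v::finite \<Rightarrow>\<^sub>0 nat"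
  assumes "2 * s + 2 * i < mdegree a \<or> CARD('v) < mdegree a"
  shows "acyclic_at TYPE('k::comm_ring_1)
    {\<sigma>. \<sigma> \<subseteq> Poly_Mapping.keys a \<and> contains_matchable E s (a - indicator_exp \<sigma>)} i"
    (is "acyclic_at _ ?\<Delta> i")
proof (cases "\<exists>x. 2 \<le> Poly_Mapping.lookup a x")
  case True
  then obtain x where x: "2 \<le> Poly_Mapping.lookup a x" by blast
  have "Poly_Mapping.keys (a - indicator_exp (insert x \<sigma>)) = Poly_Mapping.keys (a - indicator_exp \<sigma>)" for \<sigma>
    using x by (auto simp: in_keys_iff lookup_minus lookup_indicator_exp)
  moreover have "x \<in> Poly_Mapping.keys a" using x by (simp add: in_keys_iff)
  ultimately show ?thesis
    by (intro acyclic_at_cone[of _ x]) (simp add: contains_matchable_def)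
next
  case False
  then have lt: "Poly_Mapping.lookup a x < 2" for x by (simp add: not_le)
  have "Poly_Mapping.lookup a x = (if x \<in> Poly_Mapping.keys a then 1 else 0)" for x
    using less_2_cases[OF lt[of x]] by (auto simp: in_keys_iff)
  then have a: "a = indicator_exp (Poly_Mapping.keys a)"
    by (intro poly_mapping_eqI) (simp add: lookup_indicator_exp)
  have deg: "mdegree a = card (Poly_Mapping.keys a)"
    by (subst a) (rule mdegree_indicator_exp)
  have "Poly_Mapping.keys (a - indicator_exp \<sigma>) = Poly_Mapping.keys a - \<sigma>" for \<sigma>
    by (subst a) (auto simp: in_keys_iff lookup_minus lookup_indicator_exp split: if_splits)
  then have "?\<Delta> = avoiding (matchable E) (Poly_Mapping.keys a) s"
    by (simp add: avoiding_def contains_matchable_def)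
  moreover have "2 * i + 2 * s < card (Poly_Mapping.keys a)"
    using assms card_mono[of UNIV "Poly_Mapping.keys a"] unfolding deg by auto
  ultimately show ?thesis
    using acyclic_at_avoiding[OF even_delta_matroid_matchable] by simp
qed

lemma koszul_exact_squarefree_power:
  fixes c :: "'v::finite set \<Rightarrow> ('v, 'k::comm_ring_1) mpoly"
  assumes c: "koszul_chain i d c" and cyc: "\<And>\<sigma>. koszul c \<sigma> = 0"
    and I: "\<And>\<sigma>. c \<sigma> \<in> squarefree_power (edge_ideal E) s"
    and d: "int (2 * s + 2 * i) < d \<or> int CARD('v) < d"
  shows "\<exists>U. koszul U = c \<and> (\<forall>\<sigma>. U \<sigma> \<in> squarefree_power (edge_ideal E) s)"
proof (rule koszul_exact[OF c cyc, of "contains_matchable E s"])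
  show "acyclic_at TYPE('k)
      {\<sigma>. \<sigma> \<subseteq> Poly_Mapping.keys a \<and> contains_matchable E s (a - indicator_exp \<sigma>)} i"
    if "int (mdegree a) = d" for a
    using d that by (intro acyclic_at_strand) auto
  show "contains_matchable E s m" if "m \<in> Poly_Mapping.keys (c \<sigma>)" for \<sigma> m
    using keys_squarefree_power[OF I that] .
qed (use squarefree_powerI in blast)

section \<open>Koszul homology and minimal resolutions\<close>

lemma koszul_chain_sum:
  assumes "\<And>b. b \<in> B \<Longrightarrow> koszul_chain q d (c b)"
  shows "koszul_chain q d (\<lambda>\<sigma>. \<Sum>b\<in>B. c b \<sigma>)"
  unfolding koszul_chain_def
proof (intro allI ballI)
  fix \<sigma> m assume "m \<in> Poly_Mapping.keys (\<Sum>b\<in>B. c b \<sigma>)"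
  then obtain b where "b \<in> B" "m \<in> Poly_Mapping.keys (c b \<sigma>)"
    using Poly_Mapping.keys_sum[of "\<lambda>b. c b \<sigma>" B] by auto
  then show "card \<sigma> = q \<and> int (mdegree m) + int q = d"
    using assms by (auto simp: koszul_chain_def)
qed

lemma koszul_chain_times:
  assumes "homogeneous e f" "koszul_chain q d c"
  shows "koszul_chain q (e + d) (\<lambda>\<sigma>. f * c \<sigma>)"
  unfolding koszul_chain_def
proof (intro allI ballI)
  fix \<sigma> m assume "m \<in> Poly_Mapping.keys (f * c \<sigma>)"
  then obtain m1 m2 where "m = m1 + m2" "m1 \<in> Poly_Mapping.keys f" "m2 \<in> Poly_Mapping.keys (c \<sigma>)"
    using keys_mult[of f "c \<sigma>"] by auto
  then show "card \<sigma> = q \<and> int (mdegree m) + int q = e + d"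
    using assms by (auto simp: koszul_chain_def homogeneous_def mdegree_plus)
qed

lemma lookup_irrelevant_times_0:
  assumes "f \<in> irrelevant_ideal"
  shows "Poly_Mapping.lookup (f * g) (0 :: 'v::finite \<Rightarrow>\<^sub>0 nat) = (0 :: 'k::comm_ring_1)"
proof -
  have "m \<noteq> 0" if "m \<in> Poly_Mapping.keys (g * f)" for m
  proof (rule keys_ideal_gen[where P = "\<lambda>m. m \<noteq> 0" and B = "range var"])
    show "g * f \<in> ideal_gen (range var)"
      using assms by (simp add: irrelevant_ideal_def ideal_gen_times)
    show "m' + m \<noteq> 0" if nz: "m \<noteq> 0" for m m' :: "'v \<Rightarrow>\<^sub>0 nat"
    proof -
      obtain x where "Poly_Mapping.lookup m x \<noteq> 0"
        using nz by (metis lookup_zero poly_mapping_eqI)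
      then have "Poly_Mapping.lookup (m' + m) x \<noteq> 0" by (simp add: lookup_add)
      then show ?thesis by (metis lookup_zero)
    qed
    show "m \<noteq> 0" if p: "p \<in> range var" "m \<in> Poly_Mapping.keys p" for p :: "('v, 'k) mpoly" and m
    proof -
      obtain x where "m = Poly_Mapping.single x 1" using p by (auto simp: keys_var)
      then show ?thesis by (metis lookup_single_eq lookup_zero zero_neq_one)
    qed
  qed (rule that)
  then show ?thesis by (auto simp: in_keys_iff mult.commute)
qed

lemma lookup_koszul_0: "Poly_Mapping.lookup (koszul c \<sigma>) 0 = 0"
  by (simp add: koszul_def lookup_sum lookup_sg_times lookup_var_times)

text \<open>
  The degrees of the generators of \<open>F\<^sub>i\<close> are those in which \<open>Tor\<^sub>i(I, k)\<close> does not vanish. This is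
  shown with the double complex of the resolution and the Koszul complex.
\<close>

lemma no_generator_if_koszul_exact:
  fixes I :: "('v::finite, 'k::field) mpoly set"
  assumes res: "minimal_graded_free_resolution I sh D"
    and exact: "\<And>c. koszul_chain i d c \<Longrightarrow> (\<And>\<sigma>. koszul c \<sigma> = 0) \<Longrightarrow> (\<And>\<sigma>. c \<sigma> \<in> I) \<Longrightarrow>
      \<exists>U. koszul U = c \<and> (\<forall>\<sigma>. U \<sigma> \<in> I)"
    and g: "g < length (sh i)"
  shows "sh i ! g \<noteq> d"
proof
  assume d: "sh i ! g = d"
  define r where "r p = length (sh p)" for p
  \<comment> \<open>\<open>R p\<close> is the rank of \<open>F\<^bsub>p-1\<^esub>\<close>, where \<open>F\<^bsub>-1\<^esub> = S\<close>.\<close>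
  define R where "R p = (case p of 0 \<Rightarrow> 1 | Suc q \<Rightarrow> r q)" for p
  \<comment> \<open>The maps act on sequences of which only the first \<open>r p\<close> entries
    count; this avoids vector carriers in the diagram chase.\<close>
  define ap where "ap p u a = (\<Sum>b<r p. D p $$ (a, b) * u b)" for p and u :: "nat \<Rightarrow> ('v, 'k) mpoly" and a
  have D: "D p \<in> carrier_mat (R p) (r p)" for p
    using res by (cases p) (simp_all add: minimal_graded_free_resolution_def R_def r_def)
  have ap: "(D p *\<^sub>v u) $ a = ap p (\<lambda>b. u $ b) a" if "a < R p" "u \<in> carrier_vec (r p)" for p u a
    using that D[of p] by (auto simp: ap_def scalar_prod_def lessThan_atLeast0)
  have ap_vec: "(D p *\<^sub>v vec (r p) u) $ a = ap p u a" if "a < R p" for p u a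
    using ap[OF that, of "vec (r p) u"] by (simp add: ap_def)
  have im_ker: "{D (Suc p) *\<^sub>v w | w. w \<in> carrier_vec (r (Suc p))} =
      {u \<in> carrier_vec (r p). D p *\<^sub>v u = 0\<^sub>v (dim_row (D p))}" for p
    using res unfolding minimal_graded_free_resolution_def r_def by blast
  have lift: "\<exists>w. \<forall>b<r p. u b = ap (Suc p) w b" if "\<And>a. a < R p \<Longrightarrow> ap p u a = 0" for p u
  proof -
    have "D p *\<^sub>v vec (r p) u = 0\<^sub>v (dim_row (D p))"
      using D[of p] by (intro eq_vecI) (simp_all add: ap_vec that del: index_mult_mat_vec)
    then have "vec (r p) u \<in> {D (Suc p) *\<^sub>v w | w. w \<in> carrier_vec (r (Suc p))}"
      unfolding im_ker by simp
    then obtain w where w: "vec (r p) u = D (Suc p) *\<^sub>v w" "w \<in> carrier_vec (r (Suc p))" by blast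
    have "u b = ap (Suc p) (\<lambda>c. w $ c) b" if "b < r p" for b
      using ap[of b "Suc p" w] w that by (metis R_def index_vec nat.simps(5))
    then show ?thesis by blast
  qed
  have ap_ap: "ap p (ap (Suc p) w) a = 0" if "a < R p" for p w a
  proof -
    let ?u = "D (Suc p) *\<^sub>v vec (r (Suc p)) w"
    have u: "?u \<in> carrier_vec (r p)" "D p *\<^sub>v ?u = 0\<^sub>v (dim_row (D p))"
      using im_ker[of p] by (blast intro: vec_carrier)+
    have "ap p (ap (Suc p) w) a = ap p (\<lambda>b. ?u $ b) a"
      unfolding ap_def[of p] by (rule sum.cong) (auto simp: ap_vec R_def simp del: index_mult_mat_vec)
    also have "\<dots> = 0"
      using ap[OF that u(1)] u(2) D[of p] that by simp
    finally show ?thesis .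
  qed
  have I: "I = {(D 0 *\<^sub>v u) $ 0 | u. u \<in> carrier_vec (r 0)}"
    using res unfolding minimal_graded_free_resolution_def r_def by blast
  have ap_0_in: "ap 0 u 0 \<in> I" for u
    unfolding I by (rule CollectI, rule exI[of _ "vec (r 0) u"])
      (simp add: ap_vec R_def del: index_mult_mat_vec)
  have ap_0_lift: "\<exists>u. f = ap 0 u 0" if "f \<in> I" for f
    using that ap[of 0 0] unfolding I by (auto simp: R_def simp del: index_mult_mat_vec)
  have hom_0: "homogeneous (sh 0 ! b) (D 0 $$ (0, b))" if "b < r 0" for b
    using res that unfolding minimal_graded_free_resolution_def r_def by blast
  have hom_Suc: "homogeneous (sh (Suc p) ! b - sh p ! a) (D (Suc p) $$ (a, b))"
    if "a < r p" "b < r (Suc p)" for p a b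
    using res that unfolding minimal_graded_free_resolution_def r_def by blast
  \<comment> \<open>Minimality enters here: images under the maps between the free modules have no
    constant term.\<close>
  have const: "Poly_Mapping.lookup (ap (Suc p) u a) 0 = 0" if "a < r p" for p u a
  proof -
    have "D (Suc p) $$ (a, b) \<in> irrelevant_ideal" if "b < r (Suc p)" for b
      using res \<open>a < r p\<close> that unfolding minimal_graded_free_resolution_def r_def by blast
    then show ?thesis by (simp add: ap_def lookup_sum lookup_irrelevant_times_0)
  qed
  have koszul_ap: "koszul (\<lambda>\<sigma>. ap p (\<lambda>b. w b \<sigma>) a) \<sigma> = ap p (\<lambda>b. koszul (w b) \<sigma>) a" for p w a \<sigma>
    unfolding ap_def by (rule koszul_sum)
  have ap_diff: "ap p (\<lambda>b. u b - v b) a = ap p u a - ap p v a" for p u v a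
    by (simp add: ap_def right_diff_distrib sum_subtractf)
  \<comment> \<open>The difference of \<open>w\<close> and the Koszul boundary of \<open>v\<close>
    is a cycle of the resolution for each \<open>\<sigma>\<close> separately, and so lifts one
    step.\<close>
  have lift_chain: "\<exists>v'. \<forall>b<r p. \<forall>\<sigma>. w b \<sigma> = koszul (v b) \<sigma> + ap (Suc p) (\<lambda>c. v' c \<sigma>) b"
    if "\<And>a \<sigma>. a < R p \<Longrightarrow> ap p (\<lambda>b. w b \<sigma>) a = ap p (\<lambda>b. koszul (v b) \<sigma>) a" for p w v
  proof -
    have "\<exists>x. \<forall>b<r p. w b \<sigma> - koszul (v b) \<sigma> = ap (Suc p) x b" for \<sigma>
      by (rule lift) (simp add: ap_diff that)
    then obtain x where "\<And>\<sigma> b. b < r p \<Longrightarrow> w b \<sigma> - koszul (v b) \<sigma> = ap (Suc p) (x \<sigma>) b"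
      by metis
    then have "\<forall>b<r p. \<forall>\<sigma>. w b \<sigma> = koszul (v b) \<sigma> + ap (Suc p) (\<lambda>c. x \<sigma> c) b"
      by (metis add.commute diff_add_cancel)
    then show ?thesis by (intro exI[of _ "\<lambda>c \<sigma>. x \<sigma> c"])
  qed

  \<comment> \<open>An element of \<open>F\<^sub>p \<otimes> K\<^sub>q\<close> killed by the composite of the two differentials is the sum of a
    Koszul boundary and of an element of the image of \<open>F\<^bsub>p+1\<^esub> \<otimes> K\<^sub>q\<close>; the induction on \<open>p\<close> zigzags
    down to \<open>F\<^sub>0 \<otimes> K\<^sub>i\<close>, where the exactness for \<open>I\<close> is used.\<close>
  have decompose: "\<exists>v v'. \<forall>b<r p. \<forall>\<sigma>. w b \<sigma> = koszul (v b) \<sigma> + ap (Suc p) (\<lambda>c. v' c \<sigma>) b"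
    if "p + q = i" "\<And>b. b < r p \<Longrightarrow> koszul_chain q (d - sh p ! b) (w b)"
      "\<And>a \<sigma>. a < R p \<Longrightarrow> koszul (\<lambda>\<sigma>. ap p (\<lambda>b. w b \<sigma>) a) \<sigma> = 0" for p q w
    using that
  proof (induction p arbitrary: q w)
    case 0
    let ?c = "\<lambda>\<sigma>. ap 0 (\<lambda>b. w b \<sigma>) 0"
    have "koszul_chain q d (\<lambda>\<sigma>. D 0 $$ (0, b) * w b \<sigma>)" if "b < r 0" for b
      using koszul_chain_times[OF hom_0[OF that] 0(2)[OF that]] by simp
    then have "koszul_chain i d ?c"
      using 0(1) unfolding ap_def by (intro koszul_chain_sum) simp
    then obtain U where U: "koszul U = ?c" "\<And>\<sigma>. U \<sigma> \<in> I"
      using exact[of ?c] 0(3)[of 0] ap_0_in by (auto simp: R_def)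
    obtain x where x: "\<And>\<sigma>. U \<sigma> = ap 0 (x \<sigma>) 0" using ap_0_lift[OF U(2)] by metis
    have "U = (\<lambda>\<sigma>. ap 0 (\<lambda>b. x \<sigma> b) 0)" using x by auto
    then have "?c \<sigma> = ap 0 (\<lambda>b. koszul (\<lambda>\<sigma>. x \<sigma> b) \<sigma>) 0" for \<sigma>
      using U(1) koszul_ap[of 0 "\<lambda>b \<sigma>. x \<sigma> b" 0 \<sigma>] by simp
    then have "\<exists>v'. \<forall>b<r 0. \<forall>\<sigma>. w b \<sigma> = koszul (\<lambda>\<sigma>. x \<sigma> b) \<sigma> + ap (Suc 0) (\<lambda>c. v' c \<sigma>) b"
      by (intro lift_chain) (simp add: R_def)
    then show ?case by (rule exI[of _ "\<lambda>b \<sigma>. x \<sigma> b"])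
  next
    case (Suc p)
    let ?c = "\<lambda>a \<sigma>. ap (Suc p) (\<lambda>b. w b \<sigma>) a"
    \<comment> \<open>The image of \<open>w\<close> is a Koszul cycle without constant term, hence a
      boundary over the polynomial ring.\<close>
    have "\<exists>U. koszul U = ?c a \<and> koszul_chain (Suc q) (d - sh p ! a) U" if a: "a < r p" for a
    proof -
      have "koszul_chain q (d - sh p ! a) (\<lambda>\<sigma>. D (Suc p) $$ (a, b) * w b \<sigma>)" if "b < r (Suc p)" for b
        using koszul_chain_times[OF hom_Suc[OF a that] Suc.prems(2)[OF that]] by simp
      then have "koszul_chain q (d - sh p ! a) (?c a)"
        unfolding ap_def by (intro koszul_chain_sum) simp
      moreover have "koszul (?c a) \<sigma> = 0" for \<sigma>
        using Suc.prems(3) a by (simp add: R_def)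
      moreover have "Poly_Mapping.lookup (?c a {}) 0 = 0" using const[OF a] .
      ultimately show ?thesis by (rule koszul_exact_polynomials) blast
    qed
    then obtain w' where w': "\<And>a. a < r p \<Longrightarrow> koszul (w' a) = ?c a"
        "\<And>a. a < r p \<Longrightarrow> koszul_chain (Suc q) (d - sh p ! a) (w' a)"
      by metis
    \<comment> \<open>Two consecutive maps of the resolution compose to zero, so the induction
      hypothesis applies to \<open>w'\<close>.\<close>
    have "koszul (\<lambda>\<sigma>. ap p (\<lambda>b. w' b \<sigma>) a) \<sigma> = 0" if "a < R p" for a \<sigma>
    proof -
      have "koszul (\<lambda>\<sigma>. ap p (\<lambda>b. w' b \<sigma>) a) \<sigma> = ap p (ap (Suc p) (\<lambda>b. w b \<sigma>)) a"
        unfolding koszul_ap unfolding ap_def[of p] by (rule sum.cong) (auto simp: w'(1))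
      then show ?thesis using ap_ap[OF that] by simp
    qed
    then obtain v v' where v: "\<And>b \<sigma>. b < r p \<Longrightarrow> w' b \<sigma> = koszul (v b) \<sigma> + ap (Suc p) (\<lambda>c. v' c \<sigma>) b"
      using Suc.IH[of "Suc q" w'] Suc.prems(1) w'(2) by auto
    \<comment> \<open>Applying the Koszul differential to the decomposition of \<open>w'\<close>
      kills its summand \<open>koszul (v a)\<close>.\<close>
    have "?c a \<sigma> = ap (Suc p) (\<lambda>b. koszul (v' b) \<sigma>) a" if a: "a < r p" for a \<sigma>
    proof -
      have "w' a = (\<lambda>\<sigma>. koszul (v a) \<sigma> + ap (Suc p) (\<lambda>c. v' c \<sigma>) a)"
        using v[OF a] by auto
      then have "?c a = koszul (\<lambda>\<sigma>. koszul (v a) \<sigma> + ap (Suc p) (\<lambda>c. v' c \<sigma>) a)"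
        using w'(1)[OF a] by simp
      then have "?c a \<sigma> = koszul (\<lambda>\<sigma>. koszul (v a) \<sigma> + ap (Suc p) (\<lambda>c. v' c \<sigma>) a) \<sigma>"
        by (rule fun_cong)
      then show ?thesis by (simp add: koszul_add koszul_koszul koszul_ap)
    qed
    then show ?case
      using lift_chain[of "Suc p" w v'] by (auto simp: R_def)
  qed

  \<comment> \<open>The basis element \<open>g\<close> of \<open>F\<^sub>i\<close> would be a sum of two elements of $\mathfrak m F_i$.\<close>
  define e :: "nat \<Rightarrow> 'v set \<Rightarrow> ('v, 'k) mpoly" where
    "e b \<sigma> = (if b = g \<and> \<sigma> = {} then 1 else 0)" for b \<sigma>
  \<comment> \<open>Only \<open>b = g\<close> has a nonzero entry, the constant 1, and there the
    required degree is 0.\<close>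
  have "koszul_chain 0 (d - sh i ! b) (e b)" for b
    by (auto simp: koszul_chain_def e_def d mdegree_def)
  moreover have "koszul (e b) \<sigma> = 0" for b \<sigma>
    by (simp add: koszul_def e_def)
  then have "koszul (\<lambda>\<sigma>. ap i (\<lambda>b. e b \<sigma>) a) \<sigma> = 0" for a \<sigma>
    unfolding koszul_ap by (simp add: ap_def)
  ultimately obtain v v' where
    "\<And>b \<sigma>. b < r i \<Longrightarrow> e b \<sigma> = koszul (v b) \<sigma> + ap (Suc i) (\<lambda>c. v' c \<sigma>) b"
    using decompose[of i 0 e] by auto
  then have "e g {} = koszul (v g) {} + ap (Suc i) (\<lambda>c. v' c {}) g"
    using g by (simp add: r_def)
  then have "Poly_Mapping.lookup (e g {}) 0 = 0"
    using g by (simp add: lookup_add lookup_koszul_0 const r_def)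
  then show False by (simp add: e_def)
qed

section \<open>Regularity\<close>

text \<open>A bound for all minimal resolutions covers the one picked by \<open>SOME\<close>. If
  there is none, all Betti numbers are 0 and the supremum of the empty set is minus
  infinity.\<close>

lemma regularity_le_if_shifts_le:
  assumes "\<And>sh D i b. minimal_graded_free_resolution I sh D \<Longrightarrow> b < length (sh i) \<Longrightarrow>
    sh i ! b - int i \<le> k"
  shows "regularity I \<le> ereal (real_of_int k)"
  unfolding regularity_def
proof (rule SUP_least)
  fix q assume "q \<in> {(i, j). graded_betti I i j \<noteq> 0}"
  then obtain i j where q: "q = (i, j)" and "graded_betti I i j \<noteq> 0" by auto
  then have ex: "\<exists>sh D. minimal_graded_free_resolution I sh D"
    and count: "count_list ((SOME sh. \<exists>D. minimal_graded_free_resolution I sh D) i) j \<noteq> 0"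
    by (auto simp: graded_betti_def split: if_splits)
  define sh where "sh = (SOME sh. \<exists>D. minimal_graded_free_resolution I sh D)"
  obtain D where D: "minimal_graded_free_resolution I sh D"
    using someI_ex[OF ex] unfolding sh_def by blast
  have "j \<in> set (sh i)" using count by (auto simp: sh_def count_list_0_iff)
  then obtain b where b: "b < length (sh i)" "sh i ! b = j" by (auto simp: in_set_conv_nth)
  have "j - int i \<le> k" using assms[OF D b(1)] b(2) by simp
  then show "(case q of (i, j) \<Rightarrow> ereal (real_of_int (j - int i))) \<le> ereal (real_of_int k)"
    by (simp add: q)
qed

lemma regularity_squarefree_power_le:
  fixes E :: "'v::finite set set"
  shows "regularity (squarefree_power (edge_ideal E :: ('v, 'k::field) mpoly set) s)
    \<le> ereal (real (s + CARD('v) div 2))"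
proof -
  let ?I = "squarefree_power (edge_ideal E :: ('v, 'k) mpoly set) s"
  have "sh i ! b - int i \<le> int (s + CARD('v) div 2)"
    if res: "minimal_graded_free_resolution ?I sh D" and b: "b < length (sh i)" for sh D i b
  proof -
    have "\<not> (int (2 * s + 2 * i) < sh i ! b \<or> int CARD('v) < sh i ! b)"
    proof
      assume large: "int (2 * s + 2 * i) < sh i ! b \<or> int CARD('v) < sh i ! b"
      \<comment> \<open>The degree \<open>d\<close> of \<open>no_generator_if_koszul_exact\<close>
        is taken to be the shift itself, which makes its conclusion absurd.\<close>
      have "sh i ! b \<noteq> sh i ! b"
        using koszul_exact_squarefree_power[OF _ _ _ large]
        by (rule no_generator_if_koszul_exact[OF res _ b])
      then show False by simp
    qed
    then show ?thesis by linarith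
  qed
  then have "regularity ?I \<le> ereal (real_of_int (int (s + CARD('v) div 2)))"
    by (rule regularity_le_if_shifts_le)
  then show ?thesis by simp
qed

theorem theorem3p5:
  fixes E :: "'v::finite set set"
  assumes "simple_graph E"
  shows "(\<forall>s. 1 \<le> s \<and> s \<le> match_number E \<longrightarrow>
            regularity (squarefree_power (edge_ideal E :: ('v, 'k::field) mpoly set) s)
              \<le> ereal (real (s + CARD('v) div 2))) \<and>
         ((\<exists>M. matching E M \<and> card M = CARD('v) div 2) \<longrightarrow>
            (\<forall>s. 1 \<le> s \<and> s \<le> match_number E \<longrightarrow>
               regularity (squarefree_power (edge_ideal E :: ('v, 'k) mpoly set) s)
                 \<le> ereal (real (match_number E + s))))"
proof (intro conjI allI impI)
  show "regularity (squarefree_power (edge_ideal E :: ('v, 'k) mpoly set) s)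
      \<le> ereal (real (s + CARD('v) div 2))" for s
    by (rule regularity_squarefree_power_le)
next
  fix s
  assume "\<exists>M. matching E M \<and> card M = CARD('v) div 2"
  then obtain M where M: "matching E M" "card M = CARD('v) div 2" by blast
  have "card M \<le> match_number E"
    unfolding match_number_def using M(1) by (intro Max_ge) auto
  then have "ereal (real (s + CARD('v) div 2)) \<le> ereal (real (match_number E + s))"
    using M(2) by simp
  then show "regularity (squarefree_power (edge_ideal E :: ('v, 'k) mpoly set) s)
      \<le> ereal (real (match_number E + s))"
    by (rule order_trans[OF regularity_squarefree_power_le])
qed

end
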